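(* Let $Q,G$ be the generators on $\mathcal X=\mathcal Y\times\mathcal Z$ described in the context, and $L^\varepsilon=\frac1\varepsilon Q+G$. For all $c_0,C_0>0$ there exist constants $\varepsilon_0,C_1,C_2,\beta>0$ such that the following holds. For $\varepsilon\in(0,\varepsilon_0)$ let $t\mapsto\mu_t^\varepsilon\in\mathcal P(\mathcal X)$ and $t\mapsto\eta_t^\varepsilon\in\mathcal P(\mathcal Y)$ be the solutions to $$\frac{\mathrm d}{\mathrm dt}\mu_t^\varepsilon=(L^\varepsilon)^T\mu_t^\varepsilon,\quad \mu^\varepsilon_{t=0}=\mu_0^\varepsilon,\qquad\qquad \frac{\mathrm d}{\mathrm dt}\eta_t^\varepsilon=(N^\varepsilon)^T\eta_t^\varepsilon,\quad \eta^\varepsilon_{t=0}=\eta_0^\varepsilon,$$ and write $\hat\mu_t^\varepsilon=\xi_\#\mu_t^\varepsilon$. Assume that the initial conditions satisfy: - (strictly positive initial data) $\hat\mu_0^\varepsilon(y)\ge c_0$ and $\eta_0^\varepsilon(y)\ge c_0$ for all $\varepsilon\in(0,\varepsilon_0)$ and all $y\in\mathcal Y$; - (convergence) $\mu_0^\varepsilon$ converges in $\mathcal P(\mathcal X)$, and $\hat\mu_0^\varepsilon$ and $\eta_0^\varepsilon$ converge in $\mathcal P(\mathcal Y)$, as $\varepsilon\to0$; - (relative entropy estimate) $\mathscr H_{\eta_0^\varepsilon}\bigl(\hat\mu_0^\varepsilon/\eta_0^\varepsilon\bigr)\le C_0\varepsilon$ for all $\varepsilon\in(0,\varepsilon_0)$.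 Then $$\mathscr H_{\eta_t^\varepsilon}\Bigl(\frac{\hat\mu_t^\varepsilon}{\eta_t^\varepsilon}\Bigr)\le\varepsilon\,C_1e^{-\beta t}$$ for all $t\ge0$ and all $\varepsilon\in(0,\varepsilon_0)$. In particular, the time-uniform estimate $$\sup_{t\ge0}\mathscr H_{\eta_t^\varepsilon}\Bigl(\frac{\hat\mu_t^\varepsilon}{\eta_t^\varepsilon}\Bigr)\le C_2\,\varepsilon$$ holds for all $\varepsilon\in(0,\varepsilon_0)$.
   Context: $\mathcal Y=\{0,1\}$, $\mathcal Z=\{0,\dots,n-1\}$ with $n\ge1$, $\mathcal X=\mathcal Y\times\mathcal Z$. $\mathcal P(\cdot)$ denotes the set of probability measures on a finite set. A generator is a real square matrix with off-diagonal entries $\ge0$ and rows summing to $0$; reversibility is not assumed. The $\varepsilon$-independent generators $Q,G$ on $\mathcal X$ have the block form $$Q=\begin{pmatrix}Q_0 & 0 \\ 0 & Q_1\end{pmatrix},\qquad G=\begin{pmatrix}D_0 & G_{0,1} \\ G_{1,0} & D_1\end{pmatrix},$$ where all blocks are $n\times n$ matrices: $Q((y,z),(y,z'))=Q_y(z,z')$, $G((y,z),(y,z'))=D_y(z,z')$, $G((y,z),(1-y,z'))=G_{y,1-y}(z,z')\ge0$, and $D_y$ is diagonal with entries $D_y(z)=-\sum_{z'\in\mathcal Z}G_{y,1-y}(z,z')$. It is assumed that $Q_0$ and $Q_1$ are irreducible generators on $\mathcal Z$, and that for $\varepsilon>0$ the generator $L^\varepsilon=\frac1\varepsilon Q+G$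 is irreducible; $\rho^\varepsilon$ denotes its unique strictly positive steady state, $(L^\varepsilon)^T\rho^\varepsilon=0$. The coarse-graining map is $\xi:\mathcal X\to\mathcal Y$, $\xi(y,z)=y$, with level sets $\Lambda_y=\xi^{-1}(y)$; $\hat\mu_t^\varepsilon(y)=\sum_{z\in\mathcal Z}\mu_t^\varepsilon((y,z))$. Conditional measures: $\rho^\varepsilon(x|y)=\rho^\varepsilon(x)/\sum_{x'\in\Lambda_y}\rho^\varepsilon(x')$ for $x\in\Lambda_y$. The effective generator on $\mathcal Y$ is $$N^\varepsilon(y_1,y_2)=\sum_{x_1\in\Lambda_{y_1},\,x_2\in\Lambda_{y_2}}L^\varepsilon(x_1,x_2)\rho^\varepsilon(x_1|y_1).$$ For a strictly positive probability measure $\zeta$ on $\mathcal Y$, $\mathscr H_\zeta(\varphi)=\sum_{y}\varphi(y)\log\varphi(y)\,\zeta(y)$ (with $0\log0=0$). *)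

theory Defs
  imports "HOL-Analysis.Analysis" "HOL-Library.Numeral_Type"
begin

text \<open>
  The slow state space \<open>Y = {0,1}\<close> is the numeral type \<^typ>\<open>2\<close>, where \<^term>\<open>1 - y\<close> is the
  other element. The fast state space \<open>Z\<close> is an arbitrary nonempty finite type \<open>'z\<close>, with
  \<open>n = CARD('z)\<close>. Measures and matrices on a finite set are vectors and matrices indexed by it.
\<close>

definition prob_vectors :: "(real ^ 'x::finite) set" where
  "prob_vectors = {p. (\<forall>x. 0 \<le> p $ x) \<and> (\<Sum>x\<in>UNIV. p $ x) = 1}"

definition generator :: "real ^ 'x ^ 'x::finite \<Rightarrow> bool" where
  "generator A \<longleftrightarrow>
     (\<forall>x x'. x \<noteq> x' \<longrightarrow> 0 \<le> A $ x $ x') \<and> (\<forall>x. (\<Sum>x'\<in>UNIV. A $ x $ x') = 0)"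

definition irreducible_generator :: "real ^ 'x ^ 'x::finite \<Rightarrow> bool" where
  "irreducible_generator A \<longleftrightarrow>
     generator A \<and> (\<forall>x x'. (x, x') \<in> {(u, v). u \<noteq> v \<and> 0 < A $ u $ v}\<^sup>*)"

definition positive_steady_state :: "real ^ 'x ^ 'x::finite \<Rightarrow> real ^ 'x \<Rightarrow> bool" where
  "positive_steady_state A \<rho> \<longleftrightarrow>
     \<rho> \<in> prob_vectors \<and> (\<forall>x. 0 < \<rho> $ x) \<and> transpose A *v \<rho> = 0"

text \<open>The argument \<open>q y\<close> is the diagonal block \<open>Q\<^sub>y\<close>.\<close>

definition fast_generator ::
    "(2 \<Rightarrow> real ^ 'z ^ 'z::finite) \<Rightarrow> real ^ (2 \<times> 'z) ^ (2 \<times> 'z)" where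
  "fast_generator q =
     (\<chi> x x'. if fst x = fst x' then q (fst x) $ snd x $ snd x' else 0)"

text \<open>The argument \<open>g y\<close> is the off-diagonal block \<open>G\<^bsub>y,1-y\<^esub>\<close>.\<close>

definition slow_diagonal :: "(2 \<Rightarrow> real ^ 'z ^ 'z::finite) \<Rightarrow> 2 \<Rightarrow> real ^ 'z ^ 'z" where
  "slow_diagonal g y = (\<chi> z z'. if z = z' then - (\<Sum>w\<in>UNIV. g y $ z $ w) else 0)"

definition slow_generator ::
    "(2 \<Rightarrow> real ^ 'z ^ 'z::finite) \<Rightarrow> real ^ (2 \<times> 'z) ^ (2 \<times> 'z)" where
  "slow_generator g =
     (\<chi> x x'. if fst x' = fst x then slow_diagonal g (fst x) $ snd x $ snd x'
              else g (fst x) $ snd x $ snd x')"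

definition full_generator ::
    "(2 \<Rightarrow> real ^ 'z ^ 'z::finite) \<Rightarrow> (2 \<Rightarrow> real ^ 'z ^ 'z) \<Rightarrow> real \<Rightarrow>
       real ^ (2 \<times> 'z) ^ (2 \<times> 'z)" where
  "full_generator q g \<epsilon> = (1 / \<epsilon>) *\<^sub>R fast_generator q + slow_generator g"

definition cg_map :: "2 \<times> 'z \<Rightarrow> 2" where
  "cg_map x = fst x"

definition level_set :: "2 \<Rightarrow> (2 \<times> 'z::finite) set" where
  "level_set y = cg_map -` {y}"

definition cg_push :: "real ^ (2 \<times> 'z::finite) \<Rightarrow> real ^ 2" where
  "cg_push \<mu> = (\<chi> y. \<Sum>z\<in>UNIV. \<mu> $ (y, z))"

text \<open>The conditional measure \<open>\<rho>(x|y)\<close>; only meaningful for \<open>x\<close> in \<open>level_set y\<close>.\<close>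

definition cond_measure :: "real ^ (2 \<times> 'z::finite) \<Rightarrow> 2 \<times> 'z \<Rightarrow> 2 \<Rightarrow> real" where
  "cond_measure \<rho> x y = \<rho> $ x / (\<Sum>x'\<in>level_set y. \<rho> $ x')"

definition effective_generator ::
    "real ^ (2 \<times> 'z) ^ (2 \<times> 'z::finite) \<Rightarrow> real ^ (2 \<times> 'z) \<Rightarrow> real ^ 2 ^ 2" where
  "effective_generator L \<rho> =
     (\<chi> y1 y2. \<Sum>x1\<in>level_set y1. \<Sum>x2\<in>level_set y2. L $ x1 $ x2 * cond_measure \<rho> x1 y1)"

definition forward_solution ::
    "real ^ 'x ^ 'x::finite \<Rightarrow> real ^ 'x \<Rightarrow> (real \<Rightarrow> real ^ 'x) \<Rightarrow> bool" where
  "forward_solution A p0 p \<longleftrightarrow>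
     p 0 = p0 \<and>
     (\<forall>t\<ge>0. (p has_vector_derivative (transpose A *v p t)) (at t within {0..}))"

text \<open>The convention \<open>0 log 0 = 0\<close> holds because the factor \<open>\<phi> $ y\<close> vanishes.\<close>

definition entropy_fun :: "real ^ 'y::finite \<Rightarrow> real ^ 'y \<Rightarrow> real" where
  "entropy_fun \<zeta> \<phi> = (\<Sum>y\<in>UNIV. \<phi> $ y * ln (\<phi> $ y) * \<zeta> $ y)"

definition ratio_density :: "real ^ 'y::finite \<Rightarrow> real ^ 'y \<Rightarrow> real ^ 'y" where
  "ratio_density p \<zeta> = (\<chi> y. p $ y / \<zeta> $ y)"

definition converges_in_prob_vectors :: "(real \<Rightarrow> real ^ 'x::finite) \<Rightarrow> bool" where
  "converges_in_prob_vectors p \<longleftrightarrow> (\<exists>l\<in>prob_vectors. (p \<longlongrightarrow> l) (at_right 0))"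

end

theory Submission
  imports Defs
begin

text \<open>
  The difference \<open>v = \<mu> - \<rho>\<close> solves the same linear equation as \<open>\<mu>\<close> and has total mass zero. Let
  \<open>\<pi>\<close> be the stationary law of each block \<open>Q\<^sub>y\<close>, \<open>P\<close> the mass of \<open>v\<close> on the level \<open>0\<close>, \<open>w\<close> the part of
  \<open>v\<close> left after subtracting the level masses times \<open>\<pi>\<close>, and \<open>E = \<Sum> w\<^sup>2 / \<pi>\<close>. The spectral gap of the
  irreducible blocks (obtained by compactness from the Dirichlet form, without reversibility) dissipates
  \<open>E\<close> at rate \<open>1/\<epsilon>\<close>, and \<open>P\<close> relaxes at a positive rate up to an error \<open>O(|w|)\<close>. The coarse-grained
  error \<open>d\<close>, the level-\<open>0\<close> mass of \<open>\<mu>\<close> minus that of \<open>\<eta>\<close>, relaxes at a positive rate up to an error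
  \<open>O(\<epsilon> |P| + |w|)\<close>, since \<open>\<rho>(-|y)\<close> is within \<open>O(\<epsilon>)\<close> of \<open>\<pi>\<close>. Hence \<open>d\<^sup>2 + \<alpha> \<epsilon> (P\<^sup>2 + E)\<close>, with
  \<open>\<alpha>\<close> large, is a Lyapunov function decaying at a rate independent of \<open>\<epsilon>\<close>. It is initially \<open>O(\<epsilon>)\<close>
  because the entropy bounds \<open>d\<^sup>2\<close> from above, and as \<open>\<eta>\<close> stays away from zero, \<open>d\<^sup>2\<close> bounds the
  entropy from above. Nonnegativity of the coarse-grained \<open>\<mu>\<close> also comes from \<open>d\<close> being small.
\<close>

section \<open>Sums and quantifiers over the two-point space and over products\<close>

lemma UNIV_2_zero_one: "(UNIV :: 2 set) = {0, 1}"
proof -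
  have "card {0, 1 :: 2} = card (UNIV :: 2 set)" by simp
  then show ?thesis by (metis card_subset_eq finite subset_UNIV)
qed

lemma sum_UNIV_2: "(\<Sum>y\<in>(UNIV :: 2 set). f y) = f 0 + f 1"
  by (simp add: UNIV_2_zero_one)

lemma all_2_iff: "(\<forall>y :: 2. P y) \<longleftrightarrow> P 0 \<and> P 1"
  using UNIV_2_zero_one by (metis UNIV_I insertE singletonD)

lemma sum_UNIV_pair:
  "(\<Sum>x\<in>(UNIV :: ('a::finite \<times> 'b::finite) set). f x) = (\<Sum>a\<in>UNIV. \<Sum>b\<in>UNIV. f (a, b))"
  by (simp add: sum.cartesian_product flip: UNIV_Times_UNIV)

section \<open>Generators and their stationary laws\<close>

lemma transpose_mult_vec_nth:
  fixes A :: "real ^ 'x ^ 'x::finite"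
  shows "(transpose A *v v) $ x = (\<Sum>x'\<in>UNIV. A $ x' $ x * v $ x')"
  by (simp add: matrix_vector_mult_def transpose_def)

lemma sum_transpose_mult_vec_generator:
  assumes "generator A"
  shows "(\<Sum>x\<in>UNIV. (transpose A *v v) $ x) = 0"
proof -
  have "(\<Sum>x\<in>UNIV. (transpose A *v v) $ x) = (\<Sum>x'\<in>UNIV. \<Sum>x\<in>UNIV. A $ x' $ x * v $ x')"
    unfolding transpose_mult_vec_nth by (rule sum.swap)
  also have "\<dots> = 0"
    using assms by (simp add: generator_def flip: sum_distrib_right)
  finally show ?thesis .
qed

text \<open>With \<open>w = p h\<close>, expand the square: vanishing row sums kill the
  \<open>(h x)\<^sup>2\<close> terms, stationarity of \<open>p\<close> kills the
  \<open>(h x')\<^sup>2\<close> terms, and only the cross terms survive. Non-reversible generators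
  are thus covered.\<close>

lemma generator_dirichlet_form:
  fixes A :: "real ^ 'x ^ 'x::finite"
  assumes "generator A" and "\<And>x. 0 < p $ x" and "transpose A *v p = 0"
  shows "(\<Sum>x\<in>UNIV. w $ x / p $ x * (transpose A *v w) $ x) =
    - (\<Sum>x\<in>UNIV. \<Sum>x'\<in>UNIV. p $ x * A $ x $ x' * (w $ x / p $ x - w $ x' / p $ x')\<^sup>2) / 2"
proof -
  define h where "h x = w $ x / p $ x" for x
  have w: "w $ x = p $ x * h x" for x
    using assms(2)[of x] by (simp add: h_def)
  have row: "(\<Sum>x'\<in>UNIV. A $ x $ x') = 0" for x
    using assms(1) by (simp add: generator_def)
  have col: "(\<Sum>x\<in>UNIV. p $ x * A $ x $ x') = 0" for x'
  proof -
    have "(transpose A *v p) $ x' = 0" by (simp only: assms(3) zero_index)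
    then show ?thesis by (simp only: transpose_mult_vec_nth mult.commute)
  qed
  have "(\<Sum>x\<in>UNIV. \<Sum>x'\<in>UNIV. p $ x * A $ x $ x' * (h x - h x')\<^sup>2) =
      (\<Sum>x\<in>UNIV. \<Sum>x'\<in>UNIV. p $ x * (h x)\<^sup>2 * A $ x $ x') +
      (\<Sum>x\<in>UNIV. \<Sum>x'\<in>UNIV. p $ x * A $ x $ x' * (h x')\<^sup>2) -
      2 * (\<Sum>x\<in>UNIV. \<Sum>x'\<in>UNIV. p $ x * A $ x $ x' * h x * h x')"
    unfolding sum_distrib_left
    unfolding sum.distrib[symmetric] sum_subtractf[symmetric]
    by (intro sum.cong refl) (simp add: power2_eq_square algebra_simps)
  also have "(\<Sum>x\<in>UNIV. \<Sum>x'\<in>UNIV. p $ x * (h x)\<^sup>2 * A $ x $ x') = 0"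
    by (simp add: row flip: sum_distrib_left)
  also have "(\<Sum>x\<in>UNIV. \<Sum>x'\<in>UNIV. p $ x * A $ x $ x' * (h x')\<^sup>2) = 0"
    by (subst sum.swap) (simp add: col flip: sum_distrib_right)
  also have "(\<Sum>x\<in>UNIV. \<Sum>x'\<in>UNIV. p $ x * A $ x $ x' * h x * h x') =
      (\<Sum>x'\<in>UNIV. h x' * (transpose A *v w) $ x')"
    unfolding transpose_mult_vec_nth sum_distrib_left
    by (subst sum.swap, intro sum.cong refl) (simp add: w)
  finally show ?thesis by (simp add: h_def)
qed

text \<open>A diagonal entry of a generator may be negative, but here it multiplies a vanishing
  square.\<close>

lemma generator_dirichlet_form_nonneg:
  fixes A :: "real ^ 'x ^ 'x::finite"
  assumes "generator A" and "\<And>x. 0 < p $ x"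
  shows "0 \<le> p $ x * A $ x $ x' * (h x - h x' :: real)\<^sup>2"
proof (cases "x = x'")
  case False
  then show ?thesis
    using assms by (simp add: generator_def less_imp_le)
qed simp

text \<open>Positivity spreads along edges: where \<open>p\<close> vanishes, stationarity forces the
  inflow to vanish, so no edge can come from a point of positive mass. Irreducibility then reaches
  every point from one point of positive mass.\<close>

lemma irreducible_generator_stationary_pos:
  fixes A :: "real ^ 'x ^ 'x::finite"
  assumes A: "irreducible_generator A" and p: "\<And>x. 0 \<le> p $ x" "p \<noteq> 0" "transpose A *v p = 0"
  shows "0 < p $ x"
proof -
  have off: "0 \<le> A $ u $ v" if "u \<noteq> v" for u v
    using A that by (simp add: irreducible_generator_def generator_def)
  obtain x0 where "p $ x0 \<noteq> 0"
    using p(2) by (auto simp: vec_eq_iff)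
  with p(1)[of x0] have x0: "0 < p $ x0" by simp
  have step: "0 < p $ v" if uv: "0 < p $ u" "u \<noteq> v" "0 < A $ u $ v" for u v
  proof (rule ccontr)
    assume "\<not> 0 < p $ v"
    with p(1)[of v] have v: "p $ v = 0" by simp
    have "0 < A $ u $ v * p $ u" using uv by simp
    \<comment> \<open>The only entry of the column that may be negative is \<open>A $ v $ v\<close>,
      and its factor \<open>p $ v\<close> is zero.\<close>
    also have "\<dots> \<le> (\<Sum>x'\<in>UNIV. A $ x' $ v * p $ x')"
    proof (rule member_le_sum)
      fix x' assume "x' \<in> UNIV - {u}"
      show "0 \<le> A $ x' $ v * p $ x'"
        using v off[of x' v] p(1)[of x'] by (cases "x' = v") auto
    qed auto
    also have "\<dots> = 0"
      using p(3) by (metis transpose_mult_vec_nth zero_index)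
    finally show False by simp
  qed
  have "(x0, x) \<in> {(u, v). u \<noteq> v \<and> 0 < A $ u $ v}\<^sup>*"
    using A by (simp add: irreducible_generator_def)
  then show ?thesis
    by (induction rule: rtrancl_induct) (auto intro: x0 step)
qed

text \<open>The constant vector lies in the kernel of \<open>A\<close>, so the transpose is singular
  too. The entrywise absolute value of a kernel vector of the transpose is again stationary, hence
  positive by irreducibility, and can be normalised.\<close>

lemma irreducible_generator_stationary_exists:
  fixes A :: "real ^ 'x ^ 'x::finite"
  assumes A: "irreducible_generator A"
  obtains p where "\<And>x. 0 < p $ x" "(\<Sum>x\<in>UNIV. p $ x) = 1" "transpose A *v p = 0"
proof -
  have gen: "generator A" and off: "\<And>u v. u \<noteq> v \<Longrightarrow> 0 \<le> A $ u $ v"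
    and row: "\<And>u. (\<Sum>v\<in>UNIV. A $ u $ v) = 0"
    using A by (auto simp: irreducible_generator_def generator_def)
  have "A *v 1 = 0"
    by (simp add: vec_eq_iff matrix_vector_mult_def row)
  moreover have "(1 :: real ^ 'x) \<noteq> 0"
    by simp
  ultimately have "\<not> invertible A"
    by (metis invertible_def matrix_vector_mul_assoc matrix_vector_mul_lid matrix_vector_mult_0_right)
  then have "\<not> invertible (transpose A)"
    by (simp add: invertible_det_nz)
  then obtain v where v: "v \<noteq> 0" "transpose A *v v = 0"
    by (metis invertible_left_inverse matrix_left_invertible_ker)
  define a where "a = (\<chi> x. \<bar>v $ x\<bar>)"
  \<comment> \<open>\<open>a\<close> is subinvariant by the triangle inequality, hence invariant since mass is conserved.\<close>
  have sub: "0 \<le> (transpose A *v a) $ x" for x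
  proof -
    have eq: "(\<Sum>x'\<in>UNIV. A $ x' $ x * f x') = A $ x $ x * f x + (\<Sum>x'\<in>UNIV-{x}. A $ x' $ x * f x')"
      for f :: "'x \<Rightarrow> real"
      by (simp add: sum.remove)
    have diag: "A $ x $ x \<le> 0"
    proof -
      have "A $ x $ x + (\<Sum>x'\<in>UNIV-{x}. A $ x $ x') = 0"
        using row[of x] by (simp add: sum.remove)
      moreover have "0 \<le> (\<Sum>x'\<in>UNIV-{x}. A $ x $ x')"
        by (intro sum_nonneg off) auto
      ultimately show ?thesis by simp
    qed
    have "(transpose A *v v) $ x = 0" using v by simp
    then have "- A $ x $ x * v $ x = (\<Sum>x'\<in>UNIV-{x}. A $ x' $ x * v $ x')"
      unfolding transpose_mult_vec_nth eq by simp
    then have "\<bar>- A $ x $ x * v $ x\<bar> \<le> (\<Sum>x'\<in>UNIV-{x}. A $ x' $ x * \<bar>v $ x'\<bar>)"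
      using sum_abs[of "\<lambda>x'. A $ x' $ x * v $ x'" "UNIV-{x}"] off
      by (auto simp: abs_mult intro: order_trans)
    then show ?thesis
      using diag unfolding transpose_mult_vec_nth eq by (simp add: a_def abs_mult)
  qed
  have "(transpose A *v a) $ x = 0" for x
    using sum_transpose_mult_vec_generator[OF gen, of a] sub
    by (simp add: sum_nonneg_eq_0_iff)
  then have stat: "transpose A *v a = 0" by (simp add: vec_eq_iff)
  have "a \<noteq> 0" using v(1) by (auto simp: a_def vec_eq_iff)
  then have pos: "0 < a $ x" for x
    by (intro irreducible_generator_stationary_pos[OF A _ _ stat]) (simp_all add: a_def)
  define S where "S = (\<Sum>x\<in>UNIV. a $ x)"
  have S: "0 < S" unfolding S_def using pos by (intro sum_pos) auto
  show thesis
  proof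
    show "0 < ((1 / S) *\<^sub>R a) $ x" for x using pos S by simp
    show "(\<Sum>x\<in>UNIV. ((1 / S) *\<^sub>R a) $ x) = 1"
      using S by (simp add: S_def flip: sum_divide_distrib)
    show "transpose A *v ((1 / S) *\<^sub>R a) = 0"
      by (metis stat matrix_vector_mult_scaleR scaleR_zero_right)
  qed
qed

section \<open>Differential inequalities and entropy bounds\<close>

text \<open>Gronwall: \<open>V t * exp (\<beta> * t)\<close> is nonincreasing. The rate may be any
  real number; the value 0 later yields conserved quantities.\<close>

lemma exp_decay:
  fixes V V' :: "real \<Rightarrow> real"
  assumes der: "\<And>t. 0 \<le> t \<Longrightarrow> (V has_real_derivative V' t) (at t within {0..})"
    and le: "\<And>t. 0 \<le> t \<Longrightarrow> V' t \<le> - \<beta> * V t" and t: "0 \<le> t"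
  shows "V t \<le> V 0 * exp (- \<beta> * t)"
proof -
  define F where "F t = V t * exp (\<beta> * t)" for t
  have F: "(F has_real_derivative (V' t + \<beta> * V t) * exp (\<beta> * t)) (at t within {0..})"
    if "0 \<le> t" for t
    unfolding F_def
    by (rule derivative_eq_intros der that refl)+ (simp add: algebra_simps)
  have "F t \<le> F 0"
  proof (rule DERIV_nonpos_imp_decreasing_open[OF t])
    fix x assume x: "0 < x" "x < t"
    \<comment> \<open>The mean value argument needs two-sided derivatives, which agree with the
      one-sided ones at interior points; \<open>-1\<close> is a point to the left of the
      half-line.\<close>
    then have "at x within {0..} = at x"
      by (intro at_within_interior) (simp add: interior_Ici[of "-1"])
    then have "(F has_real_derivative (V' x + \<beta> * V x) * exp (\<beta> * x)) (at x)"
      using F[of x] x by simp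
    moreover have "(V' x + \<beta> * V x) * exp (\<beta> * x) \<le> 0"
      using le[of x] x by (intro mult_nonpos_nonneg) auto
    ultimately show "\<exists>y. (F has_real_derivative y) (at x) \<and> y \<le> 0" by blast
  next
    have "continuous_on {0..} F"
      using F DERIV_isCont
      by (metis atLeast_iff DERIV_continuous continuous_on_eq_continuous_within)
    then show "continuous_on {0..t} F" by (rule continuous_on_subset) auto
  qed
  then have "V t * exp (\<beta> * t) * exp (- \<beta> * t) \<le> V 0 * exp (- \<beta> * t)"
    by (intro mult_right_mono) (auto simp: F_def)
  then show ?thesis by (simp add: mult.assoc flip: exp_add)
qed

text \<open>The decay inequality holds for \<open>s\<close> and for \<open>- s\<close>.\<close>

lemma exp_decay_eq:
  fixes s :: "real \<Rightarrow> real"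
  assumes der: "\<And>t. 0 \<le> t \<Longrightarrow> (s has_real_derivative - \<beta> * s t) (at t within {0..})"
    and t: "0 \<le> t"
  shows "s t = s 0 * exp (- \<beta> * t)"
proof (rule antisym)
  show "s t \<le> s 0 * exp (- \<beta> * t)"
    by (rule exp_decay[OF der _ t]) auto
  have "((\<lambda>t. - s t) has_real_derivative - \<beta> * (- s t)) (at t within {0..})" if "0 \<le> t" for t
    using DERIV_minus[OF der[OF that]] by simp
  from exp_decay[OF this _ t] show "s 0 * exp (- \<beta> * t) \<le> s t"
    by simp
qed

section \<open>Comparison of the relative entropy with the squared error\<close>

lemma entropy_fun_ratio_density:
  assumes "\<And>y. 0 < \<eta> $ y"
  shows "entropy_fun \<eta> (ratio_density p \<eta>) = (\<Sum>y\<in>UNIV. p $ y * ln (p $ y / \<eta> $ y))"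
  unfolding entropy_fun_def ratio_density_def
  using assms by (intro sum.cong refl) (simp add: less_imp_neq[symmetric])

text \<open>A pointwise Pinsker inequality through the Hellinger distance: the logarithm bound at
  \<open>y / x\<close>, with \<open>x\<close> and \<open>y\<close> the square roots of
  \<open>a\<close> and \<open>b\<close>, controls \<open>(x - y)\<^sup>2\<close>, and
  \<open>a - b = (x + y) * (x - y)\<close> where \<open>x + y\<close> is at most 2.\<close>

lemma square_diff_le_entropy_term:
  fixes a b :: real
  assumes "0 < a" "a \<le> 1" "0 < b" "b \<le> 1"
  shows "(a - b)\<^sup>2 \<le> 4 * (a * ln (a / b) - a + b)"
proof -
  define x y where "x = sqrt a" and "y = sqrt b"
  have xy: "0 < x" "x \<le> 1" "0 < y" "y \<le> 1" and a: "a = x\<^sup>2" and b: "b = y\<^sup>2"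
    using assms by (auto simp: x_def y_def)
  have "ln (y / x) \<le> y / x - 1"
    using xy by (intro ln_le_minus_one) auto
  then have "2 * x\<^sup>2 * (1 - y / x) \<le> 2 * x\<^sup>2 * (ln x - ln y)"
    using xy by (intro mult_left_mono) (auto simp: ln_div)
  moreover have "2 * x\<^sup>2 * (1 - y / x) = 2 * x\<^sup>2 - 2 * x * y"
    using xy by (simp add: power2_eq_square field_simps)
  moreover have "2 * x\<^sup>2 * (ln x - ln y) = a * ln (a / b)"
    using xy by (simp add: a b ln_div ln_realpow)
  moreover have "(x - y)\<^sup>2 = x\<^sup>2 - 2 * x * y + y\<^sup>2"
    by (simp add: power2_eq_square algebra_simps)
  ultimately have le: "(x - y)\<^sup>2 \<le> a * ln (a / b) - a + b"
    using a b by linarith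
  have "(x + y)\<^sup>2 \<le> 2\<^sup>2"
    using xy by (intro power_mono) auto
  then have "(x + y)\<^sup>2 * (x - y)\<^sup>2 \<le> 4 * (x - y)\<^sup>2"
    by (intro mult_right_mono) auto
  also have "\<dots> \<le> 4 * (a * ln (a / b) - a + b)"
    using le by (intro mult_left_mono) auto
  also have "(x + y)\<^sup>2 * (x - y)\<^sup>2 = (a - b)\<^sup>2"
    by (simp add: a b power2_eq_square algebra_simps)
  finally show ?thesis .
qed

lemma prob_vectors_le_1: "p \<in> prob_vectors \<Longrightarrow> p $ x \<le> 1"
  unfolding prob_vectors_def
  by (metis (mono_tags, lifting) mem_Collect_eq UNIV_I finite member_le_sum)

text \<open>Summing the pointwise bound over both points, the linear terms cancel because both
  masses are one, and the two squared differences coincide; this halves the factor 4.\<close>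

lemma square_diff_le_entropy:
  fixes p \<eta> :: "real ^ 2"
  assumes p: "p \<in> prob_vectors" "\<And>y. 0 < p $ y" and \<eta>: "\<eta> \<in> prob_vectors" "\<And>y. 0 < \<eta> $ y"
  shows "(p $ 0 - \<eta> $ 0)\<^sup>2 \<le> 2 * entropy_fun \<eta> (ratio_density p \<eta>)"
proof -
  have sums: "p $ 1 = 1 - p $ 0" "\<eta> $ 1 = 1 - \<eta> $ 0"
    using p \<eta> by (auto simp: prob_vectors_def sum_UNIV_2)
  have "(p $ y - \<eta> $ y)\<^sup>2 \<le> 4 * (p $ y * ln (p $ y / \<eta> $ y) - p $ y + \<eta> $ y)" for y
    using p \<eta> by (intro square_diff_le_entropy_term prob_vectors_le_1) auto
  from this[of 0] this[of 1]
  have "(p $ 0 - \<eta> $ 0)\<^sup>2 + (p $ 1 - \<eta> $ 1)\<^sup>2 \<le> 4 * entropy_fun \<eta> (ratio_density p \<eta>)"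
    by (simp add: entropy_fun_ratio_density[OF \<eta>(2)] sum_UNIV_2 sums)
  moreover have "(p $ 1 - \<eta> $ 1)\<^sup>2 = (p $ 0 - \<eta> $ 0)\<^sup>2"
    by (simp add: sums power2_eq_square algebra_simps)
  ultimately show ?thesis by simp
qed

text \<open>The bound \<open>ln x \<le> x - 1\<close> dominates the entropy by the chi-square
  distance, whose weights are at most \<open>1 / c\<close>; the two squared differences coincide,
  which gives the factor 2.\<close>

lemma entropy_le_square_diff:
  fixes p \<eta> :: "real ^ 2"
  assumes p: "\<And>y. 0 \<le> p $ y" "p $ 0 + p $ 1 = 1"
    and \<eta>: "\<And>y. c \<le> \<eta> $ y" "\<eta> $ 0 + \<eta> $ 1 = 1" and c: "0 < c"
  shows "entropy_fun \<eta> (ratio_density p \<eta>) \<le> 2 / c * (p $ 0 - \<eta> $ 0)\<^sup>2"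
proof -
  have pos: "0 < \<eta> $ y" for y using \<eta>(1)[of y] c by simp
  have sums: "p $ 1 = 1 - p $ 0" "\<eta> $ 1 = 1 - \<eta> $ 0" using p \<eta> by auto
  have term_le: "p $ y * ln (p $ y / \<eta> $ y) \<le> (p $ y - \<eta> $ y)\<^sup>2 / c + p $ y - \<eta> $ y" for y
  proof -
    \<comment> \<open>The logarithm bound needs a positive argument; for \<open>p $ y = 0\<close>
      both sides are zero.\<close>
    have "p $ y * ln (p $ y / \<eta> $ y) \<le> p $ y * (p $ y / \<eta> $ y - 1)"
      using p(1)[of y] pos[of y]
      by (cases "p $ y = 0") (auto intro!: mult_left_mono ln_le_minus_one)
    also have "\<dots> = (p $ y - \<eta> $ y)\<^sup>2 / \<eta> $ y + p $ y - \<eta> $ y"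
      using pos[of y] by (simp add: power2_eq_square field_simps)
    also have "\<dots> \<le> (p $ y - \<eta> $ y)\<^sup>2 / c + p $ y - \<eta> $ y"
      using \<eta>(1)[of y] c by (simp add: frac_le)
    finally show ?thesis .
  qed
  have "(p $ 1 - \<eta> $ 1)\<^sup>2 = (p $ 0 - \<eta> $ 0)\<^sup>2"
    by (simp add: sums power2_eq_square algebra_simps)
  then show ?thesis
    using term_le[of 0] term_le[of 1]
    by (simp add: entropy_fun_ratio_density[OF pos] sum_UNIV_2 sums)
qed

section \<open>Block structure and spectral gap\<close>

text \<open>The mass leaving level \<open>y\<close> per unit time under the mass vector
  \<open>v\<close>. As \<open>g y\<close> holds the rates into the other level, its row sums are the
  exit rates. Signed vectors are allowed, so this is a linear functional.\<close>

definition exit_flux :: "(2 \<Rightarrow> real ^ 'z ^ 'z::finite) \<Rightarrow> real ^ (2 \<times> 'z) \<Rightarrow> 2 \<Rightarrow> real" where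
  "exit_flux g v y = (\<Sum>z\<in>UNIV. (\<Sum>w\<in>UNIV. g y $ z $ w) * v $ (y, z))"

lemma linear_exit_flux: "linear (\<lambda>v. exit_flux g v y)"
  unfolding exit_flux_def
  by (rule linearI) (simp_all add: distrib_left sum.distrib sum_distrib_left mult.left_commute)

lemma linear_cg_push_nth: "linear (\<lambda>v. cg_push v $ y)"
  unfolding cg_push_def
  by (rule linearI) (simp_all add: sum.distrib sum_distrib_left)

lemma sum_level_set:
  fixes f :: "2 \<times> 'z::finite \<Rightarrow> 'a::comm_monoid_add"
  shows "(\<Sum>x\<in>level_set y. f x) = (\<Sum>z\<in>UNIV. f (y, z))"
proof -
  have "(level_set y :: (2 \<times> 'z) set) = Pair y ` UNIV"
    by (auto simp: level_set_def cg_map_def)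
  then show ?thesis by (simp add: sum.reindex inj_on_def)
qed

lemma generator_fast_generator:
  fixes q :: "2 \<Rightarrow> real ^ 'z ^ 'z::finite"
  assumes "\<And>y. irreducible_generator (q y)"
  shows "generator (fast_generator q)"
proof -
  have off: "z \<noteq> z' \<Longrightarrow> 0 \<le> q y $ z $ z'" and row: "(\<Sum>z'\<in>UNIV. q y $ z $ z') = 0" for y z z'
    using assms[of y] by (auto simp: irreducible_generator_def generator_def)
  have "(\<Sum>x'\<in>UNIV. fast_generator q $ x $ x') = 0" for x
  proof -
    have "(\<Sum>x'\<in>UNIV. fast_generator q $ x $ x') =
        (\<Sum>y'\<in>UNIV. if fst x = y' then \<Sum>z'\<in>UNIV. q (fst x) $ snd x $ z' else 0)"
      unfolding sum_UNIV_pair by (intro sum.cong refl) (simp add: fast_generator_def)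
    then show ?thesis by (simp add: row)
  qed
  moreover have "0 \<le> fast_generator q $ x $ x'" if "x \<noteq> x'" for x x'
    using that off[of "snd x" "snd x'" "fst x"] by (auto simp: fast_generator_def prod_eq_iff)
  ultimately show ?thesis by (simp add: generator_def)
qed

text \<open>The rows of each fast block sum to zero, so the factor \<open>1 / \<epsilon>\<close>
  disappears; the diagonal and off-diagonal slow blocks contribute opposite row sums.\<close>

lemma full_generator_block_sum:
  assumes "\<And>y. irreducible_generator (q y)"
  shows "(\<Sum>z'\<in>UNIV. full_generator q g \<epsilon> $ (y, z) $ (y', z')) =
    (if y' = y then - 1 else 1) * (\<Sum>w\<in>UNIV. g y $ z $ w)"
proof -
  have "(\<Sum>z'\<in>UNIV. q y $ z $ z') = 0"
    using assms[of y] by (simp add: irreducible_generator_def generator_def)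
  then show ?thesis
    by (simp add: full_generator_def fast_generator_def slow_generator_def slow_diagonal_def
        sum.distrib flip: sum_distrib_left sum_divide_distrib)
qed

text \<open>The fast blocks conserve the level masses, so these change only through the exchange of
  exit fluxes and see no term of order \<open>1 / \<epsilon>\<close>.\<close>

lemma cg_push_full_generator:
  fixes q g :: "2 \<Rightarrow> real ^ 'z ^ 'z::finite"
  assumes "\<And>y. irreducible_generator (q y)"
  shows "cg_push (transpose (full_generator q g \<epsilon>) *v v) $ y = exit_flux g v (1 - y) - exit_flux g v y"
proof -
  have "cg_push (transpose (full_generator q g \<epsilon>) *v v) $ y =
      (\<Sum>x\<in>UNIV. \<Sum>z\<in>UNIV. full_generator q g \<epsilon> $ x $ (y, z) * v $ x)"
    by (simp only: cg_push_def vec_lambda_beta transpose_mult_vec_nth) (rule sum.swap)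
  also have "\<dots> = (\<Sum>y'\<in>UNIV. (if y = y' then - 1 else 1) * exit_flux g v y')"
    unfolding sum_UNIV_pair sum_distrib_right[symmetric] full_generator_block_sum[OF assms]
    by (simp only: exit_flux_def mult.assoc sum_distrib_left[symmetric])
  also have "\<dots> = exit_flux g v (1 - y) - exit_flux g v y"
    using all_2_iff[of "\<lambda>y. (\<Sum>y'\<in>UNIV. (if y = y' then - 1 else 1) * exit_flux g v y') =
      exit_flux g v (1 - y) - exit_flux g v y"]
    by (simp add: sum_UNIV_2)
  finally show ?thesis .
qed

text \<open>The effective chain jumps at the exit flux per unit of mass that \<open>\<rho>\<close>
  puts on the level.\<close>

lemma effective_generator_nth:
  fixes q g :: "2 \<Rightarrow> real ^ 'z ^ 'z::finite"
  assumes "\<And>y. irreducible_generator (q y)"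
  shows "effective_generator (full_generator q g \<epsilon>) \<rho> $ y $ y' =
    (if y' = y then - 1 else 1) * (exit_flux g \<rho> y / cg_push \<rho> $ y)"
  unfolding effective_generator_def cond_measure_def sum_level_set vec_lambda_beta
    sum_distrib_right[symmetric] full_generator_block_sum[OF assms]
  by (simp add: exit_flux_def cg_push_def sum_divide_distrib sum_negf)

text \<open>A vanishing flux under a positive vector forces all rates out of level \<open>y\<close>
  to vanish, so no path could ever leave that level.\<close>

lemma irreducible_full_generator_exit_pos:
  fixes q g :: "2 \<Rightarrow> real ^ 'z ^ 'z::finite"
  assumes irr: "irreducible_generator (full_generator q g \<epsilon>)" and g: "\<And>y z z'. 0 \<le> g y $ z $ z'"
    and v: "\<And>x. 0 < v $ x"
  shows "0 < exit_flux g v y"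
proof (rule ccontr)
  let ?R = "{(u, v). u \<noteq> v \<and> 0 < full_generator q g \<epsilon> $ u $ v}"
  assume "\<not> 0 < exit_flux g v y"
  moreover have nonneg: "0 \<le> (\<Sum>w\<in>UNIV. g y $ z $ w) * v $ (y, z)" for z
    using v[of "(y, z)"] by (intro mult_nonneg_nonneg sum_nonneg g) auto
  ultimately have "(\<Sum>z\<in>UNIV. (\<Sum>w\<in>UNIV. g y $ z $ w) * v $ (y, z)) = 0"
    unfolding exit_flux_def by (meson antisym not_less sum_nonneg)
  then have "(\<Sum>w\<in>UNIV. g y $ z $ w) * v $ (y, z) = 0" for z
    using nonneg by (simp add: sum_nonneg_eq_0_iff)
  then have "(\<Sum>w\<in>UNIV. g y $ z $ w) = 0" for z
    using v[of "(y, z)"] by (metis less_irrefl mult_eq_0_iff)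
  then have zero: "g y $ z $ w = 0" for z w
    using g by (simp add: sum_nonneg_eq_0_iff)
  obtain y' where y': "y' \<noteq> y" by (metis zero_neq_one)
  \<comment> \<open>\<open>undefined\<close> merely supplies some point of \<open>'z\<close>; what
    matters is that the path changes level.\<close>
  have "((y, undefined), (y', undefined)) \<in> ?R\<^sup>*"
    using irr by (simp add: irreducible_generator_def)
  then have "fst (y', undefined :: 'z) = y"
    by (induction rule: rtrancl_induct)
      (auto simp: full_generator_def fast_generator_def slow_generator_def zero split: if_splits)
  with y' show False by simp
qed

text \<open>\<open>p\<close> collects the stationary laws of the blocks, each normalised to mass one on its level.\<close>

locale fast_stationary =
  fixes q :: "2 \<Rightarrow> real ^ 'z ^ 'z::finite" and p :: "real ^ (2 \<times> 'z)"
  assumes q: "\<And>y. irreducible_generator (q y)"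
    and p_pos: "\<And>x. 0 < p $ x"
    and p_mass: "\<And>y. cg_push p $ y = 1"
    and p_stat: "transpose (fast_generator q) *v p = 0"
begin

text \<open>The projection onto the vectors of zero mass on each level, along the span of the block
  stationary laws.\<close>

definition fast_part :: "real ^ (2 \<times> 'z) \<Rightarrow> real ^ (2 \<times> 'z)" where
  "fast_part v = (\<chi> x. v $ x - cg_push v $ fst x * p $ x)"

text \<open>The squared norm, in the space weighted by \<open>p\<close>, of the density of
  \<open>w\<close> with respect to \<open>p\<close>.\<close>

definition energy :: "real ^ (2 \<times> 'z) \<Rightarrow> real" where
  "energy w = (\<Sum>x\<in>UNIV. (w $ x)\<^sup>2 / p $ x)"

lemma linear_fast_part: "linear fast_part"
  by (rule linearI)
    (simp_all add: fast_part_def vec_eq_iff linear_add[OF linear_cg_push_nth]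
      linear_scale[OF linear_cg_push_nth] algebra_simps)

lemma p_mass': "(\<Sum>z\<in>UNIV. p $ (y, z)) = 1"
  using p_mass[of y] by (simp add: cg_push_def)

lemma cg_push_fast_part: "cg_push (fast_part v) $ y = 0"
  by (simp add: cg_push_def fast_part_def sum_subtractf p_mass' flip: sum_distrib_left)

text \<open>Here \<open>exit_flux g p y\<close> is the averaged exit rate of level \<open>y\<close>,
  so the flux is the averaged one up to an error linear in the fast part.\<close>

lemma exit_flux_decomp: "exit_flux g v y = exit_flux g (fast_part v) y + cg_push v $ y * exit_flux g p y"
  unfolding exit_flux_def fast_part_def sum_distrib_left[of "cg_push v $ y"] sum.distrib[symmetric]
  by (intro sum.cong refl) (simp add: algebra_simps)

text \<open>The fast generator is block diagonal, so rescaling \<open>p\<close> by a constant on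
  each level keeps it stationary.\<close>

lemma fast_generator_fast_part:
  "transpose (fast_generator q) *v fast_part v = transpose (fast_generator q) *v v"
proof -
  have "(\<Sum>x'\<in>UNIV. fast_generator q $ x' $ x * (cg_push v $ fst x' * p $ x')) = 0" for x
  proof -
    have "(\<Sum>x'\<in>UNIV. fast_generator q $ x' $ x * (cg_push v $ fst x' * p $ x')) =
        cg_push v $ fst x * (\<Sum>x'\<in>UNIV. fast_generator q $ x' $ x * p $ x')"
      unfolding sum_distrib_left
      by (intro sum.cong refl) (simp add: fast_generator_def)
    also have "\<dots> = cg_push v $ fst x * (transpose (fast_generator q) *v p) $ x"
      by (simp only: transpose_mult_vec_nth)
    finally show ?thesis by (simp only: p_stat zero_index mult_zero_right)
  qed
  then show ?thesis
    unfolding vec_eq_iff transpose_mult_vec_nth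
    by (simp add: fast_part_def right_diff_distrib sum_subtractf)
qed

lemma energy_nonneg: "0 \<le> energy w"
  unfolding energy_def by (intro sum_nonneg divide_nonneg_pos p_pos) auto

lemma energy_le: "\<exists>K>0. \<forall>w. energy w \<le> K * (norm w)\<^sup>2"
proof (intro exI conjI allI)
  have S: "0 \<le> (\<Sum>x\<in>UNIV. 1 / p $ x)"
    by (intro sum_nonneg) (simp add: p_pos less_imp_le)
  then show "0 < (\<Sum>x\<in>UNIV. 1 / p $ x) + 1" by simp
  fix w
  have "energy w \<le> (\<Sum>x\<in>UNIV. (norm w)\<^sup>2 / p $ x)"
    unfolding energy_def
  proof (intro sum_mono divide_right_mono)
    fix x
    have "\<bar>w $ x\<bar>\<^sup>2 \<le> (norm w)\<^sup>2"
      by (intro power_mono component_le_norm_cart) auto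
    then show "(w $ x)\<^sup>2 \<le> (norm w)\<^sup>2" by simp
  qed (use p_pos in \<open>auto simp: less_imp_le\<close>)
  also have "\<dots> = (\<Sum>x\<in>UNIV. 1 / p $ x) * (norm w)\<^sup>2"
    by (simp add: sum_distrib_right)
  finally show "energy w \<le> ((\<Sum>x\<in>UNIV. 1 / p $ x) + 1) * (norm w)\<^sup>2"
    by (simp add: distrib_right add_increasing2)
qed

text \<open>The Dirichlet form must vanish, so the density \<open>w / p\<close> is constant along
  fast edges, hence on each level by irreducibility of the blocks; zero level masses make that
  constant zero.\<close>

lemma dissipation_zero_imp_zero:
  assumes mass: "\<And>y. cg_push w $ y = 0"
    and diss: "0 \<le> (\<Sum>x\<in>UNIV. w $ x / p $ x * (transpose (fast_generator q) *v w) $ x)"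
  shows "w = 0"
proof -
  let ?F = "fast_generator q"
  define h where "h x = w $ x / p $ x" for x
  have gen: "generator ?F" by (rule generator_fast_generator[OF q])
  have nonneg: "0 \<le> p $ x * ?F $ x $ x' * (h x - h x')\<^sup>2" for x x'
    by (rule generator_dirichlet_form_nonneg[OF gen p_pos])
  have "(\<Sum>x\<in>UNIV. \<Sum>x'\<in>UNIV. p $ x * ?F $ x $ x' * (h x - h x')\<^sup>2) \<le> 0"
    using diss generator_dirichlet_form[OF gen p_pos p_stat, of w] by (simp add: h_def)
  then have *: "(\<Sum>x\<in>UNIV. \<Sum>x'\<in>UNIV. p $ x * ?F $ x $ x' * (h x - h x')\<^sup>2) = 0"
    by (intro antisym sum_nonneg nonneg)
  have zero: "p $ x * ?F $ x $ x' * (h x - h x')\<^sup>2 = 0" for x x'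
  proof -
    have "(\<Sum>x'\<in>UNIV. p $ x * ?F $ x $ x' * (h x - h x')\<^sup>2) = 0" for x
      using * by (subst (asm) sum_nonneg_eq_0_iff) (simp_all only: finite sum_nonneg nonneg ball_UNIV)
    from this[of x] show ?thesis
      by (subst (asm) sum_nonneg_eq_0_iff) (simp_all only: finite nonneg ball_UNIV)
  qed
  have const: "h (y, z) = h (y, z')" for y z z'
  proof -
    have "(z, z') \<in> {(u, v). u \<noteq> v \<and> 0 < q y $ u $ v}\<^sup>*"
      using q by (simp add: irreducible_generator_def)
    then show ?thesis
    proof (induction rule: rtrancl_induct)
      case (step u v)
      have "p $ (y, u) \<noteq> 0" using p_pos[of "(y, u)"] by simp
      then show ?case
        using zero[of "(y, u)" "(y, v)"] step by (simp add: fast_generator_def)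
    qed simp
  qed
  have "w $ (y, z) = 0" for y z
  proof -
    have "w $ (y, z') = h (y, z) * p $ (y, z')" for z'
      using p_pos[of "(y, z')"] const[of y z z'] by (simp add: h_def)
    \<comment> \<open>Since \<open>p\<close> has mass one on each level, the constant density equals
      the level mass.\<close>
    then have "cg_push w $ y = h (y, z)"
      by (simp add: cg_push_def p_mass' flip: sum_distrib_left)
    then show ?thesis
      using mass[of y] p_pos[of "(y, z)"] by (simp add: h_def)
  qed
  then show ?thesis by (auto simp: vec_eq_iff)
qed

text \<open>The quadratic form is continuous and strictly negative on the unit sphere of the vectors
  with zero level masses. By compactness it has a negative maximum there, and homogeneity of degree
  two gives the bound for all such vectors.\<close>

lemma spectral_gap:
  "\<exists>\<kappa>>0. \<forall>w. (\<forall>y. cg_push w $ y = 0) \<longrightarrow>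
    (\<Sum>x\<in>UNIV. w $ x / p $ x * (transpose (fast_generator q) *v w) $ x) \<le> - \<kappa> * (norm w)\<^sup>2"
proof -
  let ?D = "\<lambda>w. \<Sum>x\<in>UNIV. w $ x / p $ x * (transpose (fast_generator q) *v w) $ x"
  define S :: "(real ^ (2 \<times> 'z)) set" where "S = sphere 0 1 \<inter> (\<Inter>y. {w. cg_push w $ y = 0})"
  have lin: "continuous_on UNIV (\<lambda>w :: real ^ (2 \<times> 'z). cg_push w $ y)" for y
    by (intro linear_continuous_on linear_conv_bounded_linear[THEN iffD1] linear_cg_push_nth)
  have "closed {w :: real ^ (2 \<times> 'z). cg_push w $ y = 0}" for y
    by (intro closed_Collect_eq lin continuous_on_const)
  then have "compact S"
    unfolding S_def by (intro compact_Int_closed compact_sphere closed_INT) auto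
  moreover have "continuous_on S ?D"
    unfolding transpose_mult_vec_nth
    by (intro continuous_intros) (use p_pos in \<open>auto simp: less_imp_neq[symmetric]\<close>)
  moreover have neg: "?D w < 0" if "w \<in> S" for w
  proof (rule ccontr)
    assume "\<not> ?D w < 0"
    with that have "w = 0"
      by (intro dissipation_zero_imp_zero) (auto simp: S_def not_less)
    with that show False by (simp add: S_def)
  qed
  ultimately obtain \<kappa> where \<kappa>: "0 < \<kappa>" "\<And>w. w \<in> S \<Longrightarrow> ?D w \<le> - \<kappa>"
  proof (cases "S = {}")
    \<comment> \<open>This is the case of a single fast state, where zero level masses leave only
      the zero vector; any constant serves.\<close>
    case True
    then show thesis using that[of 1] by auto
  next
    case False
    with \<open>compact S\<close> \<open>continuous_on S ?D\<close> obtain w0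
      where "w0 \<in> S" "\<And>w. w \<in> S \<Longrightarrow> ?D w \<le> ?D w0"
      using continuous_attains_sup by meson
    then show thesis using that[of "- ?D w0"] neg[of w0] by auto
  qed
  have "?D w \<le> - \<kappa> * (norm w)\<^sup>2" if mass: "\<forall>y. cg_push w $ y = 0" for w
  proof (cases "w = 0")
    case False
    define u where "u = (1 / norm w) *\<^sub>R w"
    have w: "w = norm w *\<^sub>R u" using False by (simp add: u_def)
    have "u \<in> S"
      using False mass linear_scale[OF linear_cg_push_nth, of "1 / norm w" w]
      by (simp add: S_def u_def)
    have "w $ x = norm w * u $ x"
      "(transpose (fast_generator q) *v w) $ x = norm w * (transpose (fast_generator q) *v u) $ x" for x
      by (subst w, simp only: matrix_vector_mult_scaleR vector_scaleR_component real_scaleR_def)+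
    then have "?D w = (\<Sum>x\<in>UNIV. (norm w * u $ x) / p $ x * (norm w * (transpose (fast_generator q) *v u) $ x))"
      by (simp only:)
    also have "\<dots> = (norm w)\<^sup>2 * ?D u"
      by (simp add: sum_distrib_left power2_eq_square ac_simps del: transpose_matrix_vector)
    also have "\<dots> \<le> (norm w)\<^sup>2 * - \<kappa>"
      using \<kappa>(2)[OF \<open>u \<in> S\<close>] by (intro mult_left_mono) auto
    finally show ?thesis by (simp only: mult.commute)
  qed simp
  with \<kappa>(1) show ?thesis by blast
qed

text \<open>The part removed by the projection has an l1 norm equal to the sum of the absolute level
  masses, because \<open>p\<close> has mass one on each level.\<close>

lemma norm_le_fast_part: "norm v \<le> norm (fast_part v) + \<bar>cg_push v $ 0\<bar> + \<bar>cg_push v $ 1\<bar>"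
proof -
  define u where "u = (\<chi> x. cg_push v $ fst x * p $ x)"
  have "v = fast_part v + u" by (simp add: fast_part_def u_def vec_eq_iff)
  then have "norm v \<le> norm (fast_part v) + norm u" by (metis norm_triangle_ineq)
  moreover have "norm u \<le> (\<Sum>x\<in>UNIV. \<bar>u $ x\<bar>)" by (rule norm_le_l1_cart)
  moreover have "\<dots> = (\<Sum>y\<in>UNIV. \<bar>cg_push v $ y\<bar>)"
    by (simp add: u_def sum_UNIV_pair abs_mult p_pos less_imp_le p_mass' flip: sum_distrib_left)
  ultimately show ?thesis by (simp add: sum_UNIV_2)
qed

lemma energy_derivative:
  assumes "(v has_vector_derivative v') (at t within T)"
  shows "((\<lambda>t. energy (fast_part (v t))) has_real_derivative
    2 * (\<Sum>x\<in>UNIV. fast_part (v t) $ x / p $ x * v' $ x)) (at t within T)"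
proof -
  have "bounded_linear (\<lambda>v. fast_part v $ x)" for x
    by (intro linear_conv_bounded_linear[THEN iffD1]
        linear_compose[OF linear_fast_part, unfolded o_def] bounded_linear.linear[OF bounded_linear_vec_nth])
  from bounded_linear.has_vector_derivative[OF this assms]
  have der: "((\<lambda>t. fast_part (v t) $ x) has_real_derivative fast_part v' $ x) (at t within T)" for x
    by (simp add: has_real_derivative_iff_has_vector_derivative)
  have "((\<lambda>t. energy (fast_part (v t))) has_real_derivative
      (\<Sum>x\<in>UNIV. 2 * (fast_part (v t) $ x * fast_part v' $ x) / p $ x)) (at t within T)"
    unfolding energy_def
    using p_pos
    by (auto intro!: derivative_eq_intros der sum.cong simp: less_imp_neq[symmetric] field_simps power2_eq_square)
  moreover have "(\<Sum>x\<in>UNIV. fast_part (v t) $ x * fast_part v' $ x / p $ x) =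
      (\<Sum>x\<in>UNIV. fast_part (v t) $ x / p $ x * v' $ x) -
      (\<Sum>x\<in>UNIV. cg_push v' $ fst x * fast_part (v t) $ x)"
    unfolding sum_subtractf[symmetric]
  proof (intro sum.cong refl)
    fix x
    have v': "fast_part v' $ x = v' $ x - cg_push v' $ fst x * p $ x" by (simp add: fast_part_def)
    show "fast_part (v t) $ x * fast_part v' $ x / p $ x =
        fast_part (v t) $ x / p $ x * v' $ x - cg_push v' $ fst x * fast_part (v t) $ x"
      using p_pos[of x] unfolding v' by (simp add: field_simps)
  qed
  moreover have "(\<Sum>x\<in>UNIV. cg_push v' $ fst x * fast_part (v t) $ x) = 0"
    using cg_push_fast_part[of "v t"]
    by (simp add: sum_UNIV_pair cg_push_def flip: sum_distrib_left)
  ultimately show ?thesis by (simp add: mult.assoc flip: sum_distrib_left times_divide_eq_right)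
qed

text \<open>The spectral gap handles the fast generator and boundedness the slow one. Both constants
  are fixed before \<open>\<epsilon>\<close> and \<open>v\<close>.\<close>

lemma energy_dissipation:
  fixes g :: "2 \<Rightarrow> real ^ 'z ^ 'z"
  shows "\<exists>\<kappa>>0. \<exists>K>0. \<forall>\<epsilon>>0. \<forall>v.
    (\<Sum>x\<in>UNIV. fast_part v $ x / p $ x * (transpose (full_generator q g \<epsilon>) *v v) $ x) \<le>
      - (\<kappa> / \<epsilon>) * (norm (fast_part v))\<^sup>2 + K * norm (fast_part v) * norm v"
proof -
  obtain \<kappa> where \<kappa>: "0 < \<kappa>" and gap: "\<And>w. \<forall>y. cg_push w $ y = 0 \<Longrightarrow>
      (\<Sum>x\<in>UNIV. w $ x / p $ x * (transpose (fast_generator q) *v w) $ x) \<le> - \<kappa> * (norm w)\<^sup>2"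
    using spectral_gap by blast
  obtain B where B: "0 < B" "\<And>v. norm (transpose (slow_generator g) *v v) \<le> B * norm v"
    using linear_bounded_pos[OF matrix_vector_mul_linear] by blast
  define P where "P = (\<Sum>x\<in>UNIV. 1 / p $ x)"
  have P: "0 < P" unfolding P_def using p_pos by (intro sum_pos) auto
  show ?thesis
  proof (intro exI conjI allI impI)
    show "0 < \<kappa>" by fact
    show "0 < P * B" using P B by simp
    fix \<epsilon> :: real and v assume \<epsilon>: "0 < \<epsilon>"
    define w where "w = fast_part v"
    define s where "s = transpose (slow_generator g) *v v"
    have split: "(transpose (full_generator q g \<epsilon>) *v v) $ x =
        (1 / \<epsilon>) * (transpose (fast_generator q) *v w) $ x + s $ x" for x
      unfolding w_def s_def fast_generator_fast_part transpose_mult_vec_nth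
      by (simp add: full_generator_def sum_distrib_left sum.distrib[symmetric] algebra_simps)
    have "(\<Sum>x\<in>UNIV. w $ x / p $ x * (transpose (full_generator q g \<epsilon>) *v v) $ x) =
        (1 / \<epsilon>) * (\<Sum>x\<in>UNIV. w $ x / p $ x * (transpose (fast_generator q) *v w) $ x) +
        (\<Sum>x\<in>UNIV. w $ x / p $ x * s $ x)"
      unfolding split sum_distrib_left sum.distrib[symmetric]
      by (intro sum.cong refl) (simp add: algebra_simps del: transpose_matrix_vector)
    also have "\<dots> \<le> (1 / \<epsilon>) * (- \<kappa> * (norm w)\<^sup>2) + P * (norm w * (B * norm v))"
    proof (intro add_mono mult_left_mono)
      show "(\<Sum>x\<in>UNIV. w $ x / p $ x * (transpose (fast_generator q) *v w) $ x) \<le> - \<kappa> * (norm w)\<^sup>2"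
        by (rule gap) (simp add: w_def cg_push_fast_part)
      have "w $ x / p $ x * s $ x \<le> 1 / p $ x * (norm w * (B * norm v))" for x
      proof -
        have "w $ x * s $ x \<le> \<bar>w $ x\<bar> * \<bar>s $ x\<bar>" by (simp flip: abs_mult)
        also have "\<dots> \<le> norm w * (B * norm v)"
          using B(2)[of v] component_le_norm_cart[of s x]
          by (intro mult_mono component_le_norm_cart) (auto simp: s_def)
        finally have "1 / p $ x * (w $ x * s $ x) \<le> 1 / p $ x * (norm w * (B * norm v))"
          using p_pos[of x] by (intro mult_left_mono) auto
        then show ?thesis by simp
      qed
      then show "(\<Sum>x\<in>UNIV. w $ x / p $ x * s $ x) \<le> P * (norm w * (B * norm v))"
        unfolding P_def sum_distrib_right by (rule sum_mono)
    qed (use \<epsilon> in auto)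
    finally show "(\<Sum>x\<in>UNIV. fast_part v $ x / p $ x * (transpose (full_generator q g \<epsilon>) *v v) $ x) \<le>
        - (\<kappa> / \<epsilon>) * (norm (fast_part v))\<^sup>2 + P * B * norm (fast_part v) * norm v"
      by (simp add: w_def ac_simps)
  qed
qed

end

lemma fast_stationary_exists:
  fixes q :: "2 \<Rightarrow> real ^ 'z ^ 'z::finite"
  assumes q: "\<And>y. irreducible_generator (q y)"
  obtains p where "fast_stationary q p"
proof -
  have "\<forall>y. \<exists>r. (\<forall>z. 0 < r $ z) \<and> (\<Sum>z\<in>UNIV. r $ z) = 1 \<and> transpose (q y) *v r = 0"
    using irreducible_generator_stationary_exists[OF q] by metis
  then obtain r where r: "\<And>y z. 0 < r y $ z" "\<And>y. (\<Sum>z\<in>UNIV. r y $ z) = 1"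
      "\<And>y. transpose (q y) *v r y = 0"
    by metis
  define p :: "real ^ (2 \<times> 'z)" where "p = (\<chi> x. r (fst x) $ snd x)"
  have "(transpose (fast_generator q) *v p) $ (y, z) = 0" for y z
  proof -
    have "(transpose (fast_generator q) *v p) $ (y, z) = (\<Sum>y'\<in>UNIV. \<Sum>z'\<in>UNIV.
        if y' = y then q y $ z' $ z * r y $ z' else 0)"
      unfolding transpose_mult_vec_nth sum_UNIV_pair
      by (intro sum.cong refl) (auto simp: fast_generator_def p_def)
    also have "\<dots> = (\<Sum>y'\<in>UNIV. if y' = y then (transpose (q y) *v r y) $ z else 0)"
      unfolding transpose_mult_vec_nth by (intro sum.cong refl) auto
    finally show ?thesis by (simp add: r(3) del: transpose_matrix_vector)
  qed
  then have "transpose (fast_generator q) *v p = 0"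
    by (auto simp: vec_eq_iff)
  then have "fast_stationary q p"
    by unfold_locales (use q r in \<open>auto simp: p_def cg_push_def\<close>)
  then show thesis by (rule that)
qed

section \<open>Decay of the coarse-grained error\<close>

text \<open>The algebra of the Lyapunov estimate in real numbers. \<open>\<sigma>\<close> stands for
  the effective relaxation rate and \<open>\<Lambda>\<close> for its limit, \<open>d\<close> for the
  coarse-grained error, \<open>p\<close> for the level mass of the difference (not the stationary
  law), \<open>j\<close> for the flux error, \<open>\<omega>\<close> for the norm of the fast part,
  \<open>E\<close> for its energy and \<open>E'\<close> for the derivative of the energy. Cross
  terms are split by Young's inequality; the weight \<open>\<alpha> * \<epsilon>\<close> turns the
  rate \<open>\<kappa> / \<epsilon>\<close> into dissipation of order one.\<close>

lemma lyapunov_dissipation: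
  fixes \<Lambda> \<kappa> K :: real
  assumes "0 < \<Lambda>" "0 < \<kappa>" "0 < K"
  obtains \<alpha> \<epsilon>\<^sub>1 \<beta> where "0 < \<alpha>" "0 < \<epsilon>\<^sub>1" "0 < \<beta>"
    "\<And>\<epsilon> \<sigma> d p j \<omega> E E'. \<lbrakk>0 < \<epsilon>; \<epsilon> < \<epsilon>\<^sub>1; \<Lambda> / 2 \<le> \<sigma>; \<bar>\<sigma> - \<Lambda>\<bar> \<le> K * \<epsilon>; \<bar>j\<bar> \<le> K * \<omega>; 0 \<le> \<omega>;
      E \<le> K * \<omega>\<^sup>2; E' \<le> - (\<kappa> / \<epsilon>) * \<omega>\<^sup>2 + K * \<omega> * (\<omega> + 2 * \<bar>p\<bar>)\<rbrakk> \<Longrightarrow>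
      2 * d * (- \<sigma> * d + (\<sigma> - \<Lambda>) * p + j) + \<alpha> * \<epsilon> * (2 * p * (- \<Lambda> * p + j) + E')
        \<le> - \<beta> * (d\<^sup>2 + \<alpha> * \<epsilon> * (p\<^sup>2 + E))"
proof
  define M where "M = K\<^sup>2 / \<Lambda>"
  \<comment> \<open>The dissipation \<open>\<alpha> * \<kappa> = 8 * M\<close> of
    \<open>\<omega>\<^sup>2\<close> is spent as follows: half on the term \<open>4 * M\<close> from
    the equation of \<open>d\<close>, a quarter on the terms multiplied by
    \<open>\<epsilon>\<close>, and the last quarter on the decay of \<open>E\<close>.\<close>
  define \<alpha> where "\<alpha> = 8 * M / \<kappa>"
  \<comment> \<open>The three bounds give \<open>\<epsilon> \<le> 1\<close>,
    \<open>\<epsilon> * \<kappa> \<le> \<Lambda>\<close> and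
    \<open>\<epsilon> * (K + 8 * M) \<le> \<kappa> / 4\<close>.\<close>
  define \<epsilon>\<^sub>1 where "\<epsilon>\<^sub>1 = min 1 (min (\<Lambda> / \<kappa>) (\<kappa> / (4 * (K + 8 * M))))"
  define \<beta> where "\<beta> = min (\<Lambda> / 2) (\<kappa> / (4 * K))"
  have M: "0 < M" using assms by (simp add: M_def)
  show \<alpha>: "0 < \<alpha>" using assms M by (simp add: \<alpha>_def)
  show "0 < \<epsilon>\<^sub>1" using assms M by (simp add: \<epsilon>\<^sub>1_def)
  show \<beta>: "0 < \<beta>" using assms by (simp add: \<beta>_def)
  \<comment> \<open>Young's inequality by completing a square; \<open>c\<close> is the share of
    \<open>\<Lambda> * x\<^sup>2\<close> that is given up.\<close>
  have young: "2 * K * x * y \<le> c * \<Lambda> * x\<^sup>2 + M / c * y\<^sup>2" if "0 < c" for c x y :: real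
  proof -
    have "0 \<le> (c * \<Lambda> * x - K * y)\<^sup>2 / (c * \<Lambda>)"
      using assms that by simp
    also have "\<dots> = c * \<Lambda> * x\<^sup>2 + M / c * y\<^sup>2 - 2 * K * x * y"
      using assms that by (simp add: M_def power2_eq_square field_simps)
    finally show ?thesis by simp
  qed
  fix \<epsilon> \<sigma> d p j \<omega> E E' :: real
  assume \<epsilon>: "0 < \<epsilon>" "\<epsilon> < \<epsilon>\<^sub>1" and \<sigma>: "\<Lambda> / 2 \<le> \<sigma>" "\<bar>\<sigma> - \<Lambda>\<bar> \<le> K * \<epsilon>" and j: "\<bar>j\<bar> \<le> K * \<omega>"
    and \<omega>: "0 \<le> \<omega>" and E: "E \<le> K * \<omega>\<^sup>2" and E': "E' \<le> - (\<kappa> / \<epsilon>) * \<omega>\<^sup>2 + K * \<omega> * (\<omega> + 2 * \<bar>p\<bar>)"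
  have \<alpha>\<epsilon>: "0 \<le> \<alpha> * \<epsilon>" using \<alpha> \<epsilon> by simp
  have \<epsilon>1: "\<epsilon> \<le> 1" and \<epsilon>2: "\<epsilon> * \<kappa> \<le> \<Lambda>" and \<epsilon>3: "\<epsilon> * (K + 8 * M) \<le> \<kappa> / 4"
    using \<epsilon> assms M by (auto simp: \<epsilon>\<^sub>1_def field_simps)
  \<comment> \<open>As \<open>2 * \<sigma>\<close> is at least \<open>\<Lambda>\<close>, each of the
    two cross terms may take a quarter of \<open>\<Lambda> * d\<^sup>2\<close> and half is
    left.\<close>
  have d_part: "2 * d * (- \<sigma> * d + (\<sigma> - \<Lambda>) * p + j) \<le>
      - (\<Lambda> / 2) * d\<^sup>2 + 4 * M * \<epsilon>\<^sup>2 * p\<^sup>2 + 4 * M * \<omega>\<^sup>2"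
  proof -
    have "(\<Lambda> / 2) * d\<^sup>2 \<le> \<sigma> * d\<^sup>2" using \<sigma> by (intro mult_right_mono) auto
    moreover have "d * ((\<sigma> - \<Lambda>) * p) \<le> K * \<bar>d\<bar> * (\<epsilon> * \<bar>p\<bar>)"
    proof -
      have "d * ((\<sigma> - \<Lambda>) * p) \<le> \<bar>d\<bar> * (\<bar>\<sigma> - \<Lambda>\<bar> * \<bar>p\<bar>)" by (simp flip: abs_mult)
      also have "\<dots> \<le> \<bar>d\<bar> * ((K * \<epsilon>) * \<bar>p\<bar>)" using \<sigma> by (intro mult_left_mono mult_right_mono) auto
      finally show ?thesis by (simp add: ac_simps)
    qed
    moreover have "d * j \<le> K * \<bar>d\<bar> * \<omega>"
    proof -
      have "d * j \<le> \<bar>d\<bar> * \<bar>j\<bar>" by (simp flip: abs_mult)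
      also have "\<dots> \<le> \<bar>d\<bar> * (K * \<omega>)" using j by (intro mult_left_mono) auto
      finally show ?thesis by (simp add: ac_simps)
    qed
    moreover have "2 * K * \<bar>d\<bar> * (\<epsilon> * \<bar>p\<bar>) \<le> \<Lambda> / 4 * d\<^sup>2 + 4 * M * (\<epsilon>\<^sup>2 * p\<^sup>2)"
      using young[of "1/4" "\<bar>d\<bar>" "\<epsilon> * \<bar>p\<bar>"] by (simp add: power_mult_distrib)
    moreover have "2 * K * \<bar>d\<bar> * \<omega> \<le> \<Lambda> / 4 * d\<^sup>2 + 4 * M * \<omega>\<^sup>2"
      using young[of "1/4" "\<bar>d\<bar>" \<omega>] by simp
    moreover have "2 * d * (- \<sigma> * d + (\<sigma> - \<Lambda>) * p + j) =
        - (2 * (\<sigma> * d\<^sup>2)) + 2 * (d * ((\<sigma> - \<Lambda>) * p)) + 2 * (d * j)"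
      by (simp add: power2_eq_square algebra_simps)
    moreover have "4 * M * \<epsilon>\<^sup>2 * p\<^sup>2 = 4 * M * (\<epsilon>\<^sup>2 * p\<^sup>2)" by simp
    ultimately show ?thesis by linarith
  qed
  have pE_part: "2 * p * (- \<Lambda> * p + j) + E' \<le>
      - (3 / 2 * \<Lambda>) * p\<^sup>2 - (\<kappa> / \<epsilon>) * \<omega>\<^sup>2 + (K + 8 * M) * \<omega>\<^sup>2"
  proof -
    have "p * j \<le> K * \<bar>p\<bar> * \<omega>"
    proof -
      have "p * j \<le> \<bar>p\<bar> * \<bar>j\<bar>" by (simp flip: abs_mult)
      also have "\<dots> \<le> \<bar>p\<bar> * (K * \<omega>)" using j by (intro mult_left_mono) auto
      finally show ?thesis by (simp add: ac_simps)
    qed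
    \<comment> \<open>The products of \<open>\<bar>p\<bar>\<close> and \<open>\<omega>\<close>
      coming from \<open>j\<close> and from \<open>E'\<close> have the same size, hence
      \<open>2 * \<omega>\<close>.\<close>
    moreover have "2 * K * \<bar>p\<bar> * (2 * \<omega>) \<le> \<Lambda> / 2 * p\<^sup>2 + 8 * M * \<omega>\<^sup>2"
      using young[of "1/2" "\<bar>p\<bar>" "2 * \<omega>"] by (simp add: power_mult_distrib)
    moreover note E'
    ultimately show ?thesis by (simp add: power2_eq_square algebra_simps)
  qed
  have "4 * M * \<epsilon>\<^sup>2 * p\<^sup>2 \<le> (\<alpha> * \<epsilon> * (\<Lambda> * p\<^sup>2)) / 2"
  proof -
    have "4 * M * \<epsilon> \<le> \<alpha> * (\<Lambda> / 2)"
      using \<epsilon>2 M assms by (simp add: \<alpha>_def field_simps)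
    then have "4 * M * \<epsilon> * (\<epsilon> * p\<^sup>2) \<le> \<alpha> * (\<Lambda> / 2) * (\<epsilon> * p\<^sup>2)"
      using \<epsilon> by (intro mult_right_mono) auto
    then show ?thesis by (simp add: power2_eq_square ac_simps)
  qed
  moreover have "4 * M * \<omega>\<^sup>2 + \<alpha> * \<epsilon> * ((K + 8 * M) * \<omega>\<^sup>2 - (\<kappa> / \<epsilon>) * \<omega>\<^sup>2) \<le> - \<beta> * (\<alpha> * \<epsilon> * E)"
  proof -
    have "\<alpha> * (\<epsilon> * (K + 8 * M)) \<le> \<alpha> * (\<kappa> / 4)"
      using \<epsilon>3 \<alpha> by (intro mult_left_mono) auto
    then have "(4 * M + \<alpha> * (\<epsilon> * (K + 8 * M)) - \<alpha> * \<kappa>) * \<omega>\<^sup>2 \<le> - (\<alpha> * \<kappa> / 4) * \<omega>\<^sup>2"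
      using assms by (intro mult_right_mono) (auto simp: \<alpha>_def)
    moreover have "\<beta> * (\<alpha> * \<epsilon> * E) \<le> \<alpha> * \<kappa> / 4 * \<omega>\<^sup>2"
    proof -
      have "\<beta> * (\<alpha> * \<epsilon> * E) \<le> \<beta> * (\<alpha> * \<epsilon> * (K * \<omega>\<^sup>2))"
        using E \<alpha>\<epsilon> \<beta> by (intro mult_left_mono) auto
      also have "\<dots> = (\<beta> * \<epsilon>) * (\<alpha> * K * \<omega>\<^sup>2)" by simp
      also have "\<dots> \<le> (\<kappa> / (4 * K) * 1) * (\<alpha> * K * \<omega>\<^sup>2)"
        using \<epsilon> \<epsilon>1 \<alpha> \<beta> assms by (intro mult_right_mono mult_mono) (auto simp: \<beta>_def)
      finally show ?thesis using assms by (simp add: ac_simps)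
    qed
    moreover have "4 * M * \<omega>\<^sup>2 + \<alpha> * \<epsilon> * ((K + 8 * M) * \<omega>\<^sup>2 - (\<kappa> / \<epsilon>) * \<omega>\<^sup>2) =
        (4 * M + \<alpha> * (\<epsilon> * (K + 8 * M)) - \<alpha> * \<kappa>) * \<omega>\<^sup>2"
      using \<epsilon> by (simp add: field_simps)
    ultimately show ?thesis by linarith
  qed
  moreover have "\<beta> * d\<^sup>2 \<le> \<Lambda> / 2 * d\<^sup>2"
    by (intro mult_right_mono) (auto simp: \<beta>_def)
  moreover have "\<beta> * (\<alpha> * \<epsilon> * p\<^sup>2) \<le> \<alpha> * \<epsilon> * (\<Lambda> * p\<^sup>2)"
  proof -
    have "\<beta> * (\<alpha> * \<epsilon> * p\<^sup>2) \<le> \<Lambda> * (\<alpha> * \<epsilon> * p\<^sup>2)"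
      using \<alpha> \<epsilon> assms by (intro mult_right_mono mult_nonneg_nonneg) (auto simp: \<beta>_def)
    then show ?thesis by (simp only: ac_simps)
  qed
  moreover have "\<alpha> * \<epsilon> * (2 * p * (- \<Lambda> * p + j) + E') \<le>
      \<alpha> * \<epsilon> * (- (3 / 2 * \<Lambda>) * p\<^sup>2 - (\<kappa> / \<epsilon>) * \<omega>\<^sup>2 + (K + 8 * M) * \<omega>\<^sup>2)"
    using pE_part \<alpha>\<epsilon> by (rule mult_left_mono)
  moreover have "\<alpha> * \<epsilon> * (- (3 / 2 * \<Lambda>) * p\<^sup>2 - (\<kappa> / \<epsilon>) * \<omega>\<^sup>2 + (K + 8 * M) * \<omega>\<^sup>2) =
      - (3 / 2) * (\<alpha> * \<epsilon> * (\<Lambda> * p\<^sup>2)) + \<alpha> * \<epsilon> * ((K + 8 * M) * \<omega>\<^sup>2 - (\<kappa> / \<epsilon>) * \<omega>\<^sup>2)"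
    by (simp add: ring_distribs)
  moreover have "- \<beta> * (d\<^sup>2 + \<alpha> * \<epsilon> * (p\<^sup>2 + E)) =
      - (\<beta> * d\<^sup>2) - \<beta> * (\<alpha> * \<epsilon> * p\<^sup>2) - \<beta> * (\<alpha> * \<epsilon> * E)"
    by (simp add: ring_distribs)
  moreover have "- (\<Lambda> / 2) * d\<^sup>2 = - (\<Lambda> / 2 * d\<^sup>2)" "- \<beta> * (\<alpha> * \<epsilon> * E) = - (\<beta> * (\<alpha> * \<epsilon> * E))"
    by simp_all
  moreover note d_part
  ultimately show "2 * d * (- \<sigma> * d + (\<sigma> - \<Lambda>) * p + j) + \<alpha> * \<epsilon> * (2 * p * (- \<Lambda> * p + j) + E')
      \<le> - \<beta> * (d\<^sup>2 + \<alpha> * \<epsilon> * (p\<^sup>2 + E))"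
    by linarith
qed

section \<open>Linear functionals along solutions and the effective two-state equation\<close>

lemma forward_solution_linear_derivative:
  fixes f :: "real ^ 'x::finite \<Rightarrow> real"
  assumes "forward_solution A p0 p" and "linear f" and "0 \<le> t"
  shows "((\<lambda>t. f (p t)) has_real_derivative f (transpose A *v p t)) (at t within {0..})"
proof -
  have "(p has_vector_derivative (transpose A *v p t)) (at t within {0..})"
    using assms by (simp add: forward_solution_def del: transpose_matrix_vector)
  then show ?thesis
    using bounded_linear.has_vector_derivative[of f] assms(2)
    by (simp add: linear_conv_bounded_linear has_real_derivative_iff_has_vector_derivative
        del: transpose_matrix_vector)
qed

lemma forward_solution_linear_constant:
  fixes f :: "real ^ 'x::finite \<Rightarrow> real"
  assumes "forward_solution A p0 p" and "linear f" and "\<And>v. f (transpose A *v v) = 0" and "0 \<le> t"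
  shows "f (p t) = f p0"
proof -
  have "f (p t) = f (p 0) * exp (- 0 * t)"
    using forward_solution_linear_derivative[OF assms(1,2)] assms(3,4)
    by (intro exp_decay_eq) (auto simp del: transpose_matrix_vector)
  then show ?thesis using assms(1) by (simp add: forward_solution_def)
qed

lemma cg_push_prob_vectors: "v \<in> prob_vectors \<Longrightarrow> cg_push v \<in> prob_vectors"
  by (auto simp: prob_vectors_def cg_push_def sum_UNIV_pair intro: sum_nonneg)

lemma prob_vectors_norm_le_1:
  assumes "v \<in> prob_vectors"
  shows "norm v \<le> 1"
proof -
  have "norm v \<le> (\<Sum>x\<in>UNIV. \<bar>v $ x\<bar>)" by (rule norm_le_l1_cart)
  also have "\<dots> = 1" using assms by (simp add: prob_vectors_def)
  finally show ?thesis .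
qed

lemma positive_steady_state_cg_push_pos:
  assumes "positive_steady_state A \<rho>"
  shows "0 < cg_push \<rho> $ y"
  using assms by (auto simp: positive_steady_state_def cg_push_def intro!: sum_pos)

text \<open>Sum the stationarity equation over level 0: the fluxes in and out must agree.\<close>

lemma positive_steady_state_flux_balance:
  fixes q g :: "2 \<Rightarrow> real ^ 'z ^ 'z::finite"
  assumes "\<And>y. irreducible_generator (q y)" and "positive_steady_state (full_generator q g \<epsilon>) \<rho>"
  shows "exit_flux g \<rho> 0 = exit_flux g \<rho> 1"
proof -
  have "transpose (full_generator q g \<epsilon>) *v \<rho> = 0"
    using assms(2) by (simp only: positive_steady_state_def)
  then have "cg_push (0 :: real ^ (2 \<times> 'z)) $ 0 = exit_flux g \<rho> (1 - 0) - exit_flux g \<rho> 0"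
    using cg_push_full_generator[of q g \<epsilon> \<rho> 0, OF assms(1)] by (simp only:)
  then show ?thesis by (simp add: cg_push_def)
qed

text \<open>Conservation of mass leaves one scalar linear equation. Flux balance makes
  \<open>cg_push \<rho>\<close> the equilibrium, so the deviation decays exactly at the sum of the
  two effective rates.\<close>

lemma effective_solution:
  fixes q g :: "2 \<Rightarrow> real ^ 'z ^ 'z::finite"
  defines "r \<equiv> \<lambda>\<rho> y. exit_flux g \<rho> y / cg_push \<rho> $ y"
  assumes q: "\<And>y. irreducible_generator (q y)"
    and \<rho>: "positive_steady_state (full_generator q g \<epsilon>) \<rho>"
    and \<eta>0: "\<eta>\<^sub>0 \<in> prob_vectors"
    and sol: "forward_solution (effective_generator (full_generator q g \<epsilon>) \<rho>) \<eta>\<^sub>0 \<eta>"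
    and t: "0 \<le> t"
  shows "\<eta> t $ 0 + \<eta> t $ 1 = 1"
    and "((\<lambda>t. \<eta> t $ 0) has_real_derivative - (r \<rho> 0 + r \<rho> 1) * (\<eta> t $ 0 - cg_push \<rho> $ 0)) (at t within {0..})"
    and "\<eta> t $ y = cg_push \<rho> $ y + (\<eta>\<^sub>0 $ y - cg_push \<rho> $ y) * exp (- (r \<rho> 0 + r \<rho> 1) * t)"
proof -
  let ?N = "effective_generator (full_generator q g \<epsilon>) \<rho>"
  define m where "m = cg_push \<rho>"
  have m: "m \<in> prob_vectors" "0 < m $ 0" "0 < m $ 1"
    using \<rho> positive_steady_state_cg_push_pos[OF \<rho>]
    by (auto simp: m_def positive_steady_state_def cg_push_prob_vectors)
  have N: "(transpose ?N *v v) $ 0 = r \<rho> 1 * v $ 1 - r \<rho> 0 * v $ 0"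
    "(transpose ?N *v v) $ 1 = r \<rho> 0 * v $ 0 - r \<rho> 1 * v $ 1" for v
    unfolding transpose_mult_vec_nth effective_generator_nth[OF q] by (auto simp: sum_UNIV_2 r_def)
  have mass: "\<eta> t $ 0 + \<eta> t $ 1 = 1" if "0 \<le> t" for t
  proof -
    have "\<eta> t $ 0 + \<eta> t $ 1 = \<eta>\<^sub>0 $ 0 + \<eta>\<^sub>0 $ 1"
      using forward_solution_linear_constant[OF sol, of "\<lambda>v. v $ 0 + v $ 1"] that
      by (simp add: N linear_iff algebra_simps del: transpose_matrix_vector)
    then show ?thesis using \<eta>0 by (simp add: prob_vectors_def sum_UNIV_2)
  qed
  show "\<eta> t $ 0 + \<eta> t $ 1 = 1" using mass t .
  \<comment> \<open>Flux balance and total mass one rewrite the constant term of the scalar equation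
    as rate times equilibrium.\<close>
  have bal: "r \<rho> 1 = (r \<rho> 0 + r \<rho> 1) * m $ 0"
  proof -
    have "r \<rho> 0 * m $ 0 = r \<rho> 1 * m $ 1"
      using positive_steady_state_flux_balance[OF q \<rho>] m by (simp add: r_def m_def)
    moreover have "m $ 1 = 1 - m $ 0" using m(1) by (simp add: prob_vectors_def sum_UNIV_2)
    ultimately show ?thesis by (simp add: algebra_simps)
  qed
  have der: "((\<lambda>t. \<eta> t $ 0) has_real_derivative - (r \<rho> 0 + r \<rho> 1) * (\<eta> t $ 0 - m $ 0)) (at t within {0..})"
    if "0 \<le> t" for t
  proof -
    have "r \<rho> 1 * \<eta> t $ 1 - r \<rho> 0 * \<eta> t $ 0 = r \<rho> 1 - (r \<rho> 0 + r \<rho> 1) * \<eta> t $ 0"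
      using mass[OF that] by (simp add: algebra_simps flip: distrib_left)
    also have "\<dots> = - (r \<rho> 0 + r \<rho> 1) * (\<eta> t $ 0 - m $ 0)"
      by (subst bal) (simp add: algebra_simps)
    finally have eq: "(transpose ?N *v \<eta> t) $ 0 = - (r \<rho> 0 + r \<rho> 1) * (\<eta> t $ 0 - m $ 0)"
      by (simp only: N)
    have "linear (\<lambda>v :: real ^ 2. v $ 0)" by (simp add: linear_iff)
    from forward_solution_linear_derivative[OF sol this that] show ?thesis by (simp only: eq)
  qed
  then show "((\<lambda>t. \<eta> t $ 0) has_real_derivative - (r \<rho> 0 + r \<rho> 1) * (\<eta> t $ 0 - cg_push \<rho> $ 0)) (at t within {0..})"
    using t by (simp add: m_def)
  have "((\<lambda>t. \<eta> t $ 0 - m $ 0) has_real_derivative - (r \<rho> 0 + r \<rho> 1) * (\<eta> t $ 0 - m $ 0)) (at t within {0..})"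
    if "0 \<le> t" for t
    using DERIV_diff[OF der[OF that] DERIV_const[of "m $ 0"]] by simp
  from exp_decay_eq[OF this t]
  have e0: "\<eta> t $ 0 - m $ 0 = (\<eta>\<^sub>0 $ 0 - m $ 0) * exp (- (r \<rho> 0 + r \<rho> 1) * t)"
    using sol by (simp add: forward_solution_def)
  have "\<forall>y. \<eta> t $ y - m $ y = (\<eta>\<^sub>0 $ y - m $ y) * exp (- (r \<rho> 0 + r \<rho> 1) * t)"
  proof (subst all_2_iff, intro conjI)
    have "\<eta> t $ 1 - m $ 1 = - (\<eta> t $ 0 - m $ 0)" "\<eta>\<^sub>0 $ 1 - m $ 1 = - (\<eta>\<^sub>0 $ 0 - m $ 0)"
      using mass[OF t] m(1) \<eta>0 by (auto simp: prob_vectors_def sum_UNIV_2)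
    then show "\<eta> t $ 1 - m $ 1 = (\<eta>\<^sub>0 $ 1 - m $ 1) * exp (- (r \<rho> 0 + r \<rho> 1) * t)"
      by (simp only: e0 minus_mult_left)
  qed (rule e0)
  then show "\<eta> t $ y = cg_push \<rho> $ y + (\<eta>\<^sub>0 $ y - cg_push \<rho> $ y) * exp (- (r \<rho> 0 + r \<rho> 1) * t)"
    by (metis m_def add.commute diff_add_cancel)
qed

section \<open>Estimates uniform in \<epsilon> that rest on the spectral gap\<close>

context fast_stationary
begin

text \<open>At a steady state the left side of the energy dissipation inequality is zero, so
  \<open>\<kappa> / \<epsilon>\<close> times the norm of the fast part is at most
  \<open>K\<close>.\<close>

lemma steady_state_fast_part_small:
  fixes g :: "2 \<Rightarrow> real ^ 'z ^ 'z"
  shows "\<exists>K>0. \<forall>\<epsilon>>0. \<forall>\<rho>. positive_steady_state (full_generator q g \<epsilon>) \<rho> \<longrightarrow> norm (fast_part \<rho>) \<le> K * \<epsilon>"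
proof -
  obtain \<kappa> K where \<kappa>: "0 < \<kappa>" and K: "0 < K" and diss: "\<And>\<epsilon> v. 0 < \<epsilon> \<Longrightarrow>
      (\<Sum>x\<in>UNIV. fast_part v $ x / p $ x * (transpose (full_generator q g \<epsilon>) *v v) $ x) \<le>
        - (\<kappa> / \<epsilon>) * (norm (fast_part v))\<^sup>2 + K * norm (fast_part v) * norm v"
    using energy_dissipation[of g] by blast
  show ?thesis
  proof (intro exI conjI allI impI)
    show "0 < K / \<kappa>" using \<kappa> K by simp
    fix \<epsilon> :: real and \<rho>
    assume \<epsilon>: "0 < \<epsilon>" and \<rho>: "positive_steady_state (full_generator q g \<epsilon>) \<rho>"
    let ?w = "norm (fast_part \<rho>)"
    have "transpose (full_generator q g \<epsilon>) *v \<rho> = 0"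
      using \<rho> by (simp only: positive_steady_state_def)
    with diss[OF \<epsilon>, of \<rho>] have "(\<kappa> / \<epsilon>) * ?w\<^sup>2 \<le> K * ?w * norm \<rho>"
      by (simp only:) simp
    also have "\<dots> \<le> K * ?w * 1"
      using \<rho> K by (intro mult_left_mono prob_vectors_norm_le_1) (auto simp: positive_steady_state_def)
    finally have "?w * ((\<kappa> / \<epsilon>) * ?w) \<le> ?w * K"
      by (simp add: power2_eq_square ac_simps)
    then have "?w = 0 \<or> (\<kappa> / \<epsilon>) * ?w \<le> K"
      by (metis less_eq_real_def mult_le_cancel_left_pos norm_ge_zero)
    then show "?w \<le> K / \<kappa> * \<epsilon>"
      using \<kappa> K \<epsilon> by (auto simp: field_simps)
  qed
qed

lemma exit_flux_bound: "\<exists>B>0. \<forall>v :: real ^ (2 \<times> 'z). \<forall>y. \<bar>exit_flux g v y\<bar> \<le> B * norm v"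
proof -
  obtain B0 where B0: "0 < B0" "\<And>v. \<bar>exit_flux g v 0\<bar> \<le> B0 * norm v"
    using linear_bounded_pos[OF linear_exit_flux[of g 0]] by auto
  obtain B1 where B1: "0 < B1" "\<And>v. \<bar>exit_flux g v 1\<bar> \<le> B1 * norm v"
    using linear_bounded_pos[OF linear_exit_flux[of g 1]] by auto
  have "\<bar>exit_flux g v 0\<bar> \<le> (B0 + B1) * norm v" "\<bar>exit_flux g v 1\<bar> \<le> (B0 + B1) * norm v" for v
    using B0(2)[of v] B1(2)[of v] B0(1) B1(1) by (auto simp: distrib_right add_increasing add_increasing2)
  with B0(1) B1(1) show ?thesis
    by (intro exI[of _ "B0 + B1"]) (simp add: all_2_iff)
qed

text \<open>Flux balance and total mass one determine the level masses of \<open>\<rho>\<close> up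
  to flux errors of order \<open>\<epsilon>\<close>. They hence stay away from zero, and the
  effective rates differ from the averaged ones only by flux error over level mass.\<close>

lemma steady_state_estimates:
  fixes g :: "2 \<Rightarrow> real ^ 'z ^ 'z"
  assumes A: "\<And>y. 0 < exit_flux g p y"
  obtains c \<epsilon>\<^sub>1 K where "0 < c" "0 < \<epsilon>\<^sub>1" "0 < K"
    "\<And>\<epsilon> \<rho> y. \<lbrakk>0 < \<epsilon>; \<epsilon> < \<epsilon>\<^sub>1; positive_steady_state (full_generator q g \<epsilon>) \<rho>\<rbrakk> \<Longrightarrow>
      c \<le> cg_push \<rho> $ y \<and> \<bar>exit_flux g \<rho> y / cg_push \<rho> $ y - exit_flux g p y\<bar> \<le> K * \<epsilon>"
proof -
  obtain K where K: "0 < K" "\<And>\<epsilon> \<rho>. 0 < \<epsilon> \<Longrightarrow> positive_steady_state (full_generator q g \<epsilon>) \<rho> \<Longrightarrow>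
      norm (fast_part \<rho>) \<le> K * \<epsilon>"
    using steady_state_fast_part_small by blast
  obtain B where B: "0 < B" "\<And>v :: real ^ (2 \<times> 'z). \<And>y. \<bar>exit_flux g v y\<bar> \<le> B * norm v"
    using exit_flux_bound by blast
  define a where "a = min (exit_flux g p 0) (exit_flux g p 1)"
  define \<Lambda> where "\<Lambda> = exit_flux g p 0 + exit_flux g p 1"
  have pos: "0 < a" "0 < \<Lambda>" using A[of 0] A[of 1] by (auto simp: a_def \<Lambda>_def)
  have BK: "0 < B * K" using B K by simp
  show thesis
  proof (rule that)
    \<comment> \<open>The limiting level masses are at least \<open>a / \<Lambda>\<close>; half of
      that survives once \<open>\<epsilon>\<close> is so small that each flux error is at most
      \<open>a / 4\<close>.\<close>
    show "0 < a / (2 * \<Lambda>)" using pos by simp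
    show "0 < a / (4 * (B * K))" using pos BK by simp
    show "0 < B * K / (a / (2 * \<Lambda>))" using pos BK by simp
    fix \<epsilon> \<rho> y
    assume \<epsilon>: "0 < \<epsilon>" "\<epsilon> < a / (4 * (B * K))" and \<rho>: "positive_steady_state (full_generator q g \<epsilon>) \<rho>"
    let ?j = "\<lambda>y. exit_flux g (fast_part \<rho>) y" and ?m = "\<lambda>y. cg_push \<rho> $ y"
    have j: "\<bar>?j y\<bar> \<le> B * K * \<epsilon>" for y
    proof -
      have "\<bar>?j y\<bar> \<le> B * norm (fast_part \<rho>)" by (rule B)
      also have "\<dots> \<le> B * (K * \<epsilon>)" using K(2)[OF \<epsilon>(1) \<rho>] B by (intro mult_left_mono) auto
      finally show ?thesis by simp
    qed
    have sum1: "?m 0 + ?m 1 = 1"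
      using \<rho> cg_push_prob_vectors[of \<rho>] by (simp add: positive_steady_state_def prob_vectors_def sum_UNIV_2)
    have small: "B * K * \<epsilon> \<le> a / 4"
      using \<epsilon>(2) BK by (simp add: field_simps)
    have bal: "?j 0 + ?m 0 * exit_flux g p 0 = ?j 1 + ?m 1 * exit_flux g p 1"
      using positive_steady_state_flux_balance[OF q \<rho>] exit_flux_decomp[of g \<rho>] by metis
    have "?m 0 * \<Lambda> = exit_flux g p 1 + ?j 1 - ?j 0" "?m 1 * \<Lambda> = exit_flux g p 0 + ?j 0 - ?j 1"
    proof -
      have m1: "?m 1 = 1 - ?m 0" using sum1 by simp
      show "?m 0 * \<Lambda> = exit_flux g p 1 + ?j 1 - ?j 0"
        using bal unfolding m1 by (simp add: \<Lambda>_def algebra_simps)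
      have m0: "?m 0 = 1 - ?m 1" using sum1 by simp
      show "?m 1 * \<Lambda> = exit_flux g p 0 + ?j 0 - ?j 1"
        using bal unfolding m0 by (simp add: \<Lambda>_def algebra_simps)
    qed
    then have "a / 2 \<le> ?m 0 * \<Lambda>" "a / 2 \<le> ?m 1 * \<Lambda>"
      using j[of 0] j[of 1] small unfolding a_def by linarith+
    then have "\<forall>y. a / (2 * \<Lambda>) \<le> ?m y"
      using pos by (simp add: all_2_iff field_simps)
    then have m: "a / (2 * \<Lambda>) \<le> ?m y" ..
    then have mpos: "0 < ?m y" using pos by (smt (verit) divide_pos_pos)
    have "\<bar>exit_flux g \<rho> y / ?m y - exit_flux g p y\<bar> = \<bar>?j y\<bar> / ?m y"
      using mpos exit_flux_decomp[of g \<rho> y] by (simp add: field_simps)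
    also have "\<dots> \<le> B * K * \<epsilon> / (a / (2 * \<Lambda>))"
      using j[of y] m pos by (intro frac_le) auto
    finally show "a / (2 * \<Lambda>) \<le> ?m y \<and>
        \<bar>exit_flux g \<rho> y / ?m y - exit_flux g p y\<bar> \<le> B * K / (a / (2 * \<Lambda>)) * \<epsilon>"
      using m by (simp add: ac_simps)
  qed
qed

text \<open>Everything needed about the solutions before entropies enter. The constants depend
  neither on \<open>\<epsilon>\<close> nor on the initial data.\<close>

lemma slow_error_decay:
  fixes g :: "2 \<Rightarrow> real ^ 'z ^ 'z"
  assumes A: "\<And>y. 0 < exit_flux g p y"
  obtains c \<epsilon>\<^sub>1 K \<beta> where "0 < c" "0 < \<epsilon>\<^sub>1" "0 < K" "0 < \<beta>"
    "\<And>\<epsilon> \<rho> \<mu>\<^sub>0 \<eta>\<^sub>0 \<mu> \<eta> t. \<lbrakk>0 < \<epsilon>; \<epsilon> < \<epsilon>\<^sub>1; positive_steady_state (full_generator q g \<epsilon>) \<rho>;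
      \<mu>\<^sub>0 \<in> prob_vectors; \<eta>\<^sub>0 \<in> prob_vectors; forward_solution (full_generator q g \<epsilon>) \<mu>\<^sub>0 \<mu>;
      forward_solution (effective_generator (full_generator q g \<epsilon>) \<rho>) \<eta>\<^sub>0 \<eta>; 0 \<le> t\<rbrakk> \<Longrightarrow>
      cg_push (\<mu> t) $ 0 + cg_push (\<mu> t) $ 1 = 1 \<and> \<eta> t $ 0 + \<eta> t $ 1 = 1 \<and>
      (\<forall>y. min c (\<eta>\<^sub>0 $ y) \<le> \<eta> t $ y) \<and>
      (cg_push (\<mu> t) $ 0 - \<eta> t $ 0)\<^sup>2 \<le>
        ((cg_push \<mu>\<^sub>0 $ 0 - \<eta>\<^sub>0 $ 0)\<^sup>2 + K * \<epsilon>) * exp (- \<beta> * t)"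
proof -
  define \<Lambda> where "\<Lambda> = exit_flux g p 0 + exit_flux g p 1"
  have \<Lambda>: "0 < \<Lambda>" using A[of 0] A[of 1] by (simp add: \<Lambda>_def)
  obtain c \<epsilon>\<^sub>2 K2 where c: "0 < c" and \<epsilon>\<^sub>2: "0 < \<epsilon>\<^sub>2" and K2: "0 < K2" and steady:
    "\<And>\<epsilon> \<rho> y. \<lbrakk>0 < \<epsilon>; \<epsilon> < \<epsilon>\<^sub>2; positive_steady_state (full_generator q g \<epsilon>) \<rho>\<rbrakk> \<Longrightarrow>
      c \<le> cg_push \<rho> $ y \<and> \<bar>exit_flux g \<rho> y / cg_push \<rho> $ y - exit_flux g p y\<bar> \<le> K2 * \<epsilon>"
    by (rule steady_state_estimates[OF A]) (rule that; blast)
  obtain \<kappa> K3 where \<kappa>: "0 < \<kappa>" and K3: "0 < K3" and diss: "\<And>\<epsilon> v. 0 < \<epsilon> \<Longrightarrow>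
      (\<Sum>x\<in>UNIV. fast_part v $ x / p $ x * (transpose (full_generator q g \<epsilon>) *v v) $ x) \<le>
        - (\<kappa> / \<epsilon>) * (norm (fast_part v))\<^sup>2 + K3 * norm (fast_part v) * norm v"
    using energy_dissipation[of g] by blast
  obtain B where B: "0 < B" "\<And>v :: real ^ (2 \<times> 'z). \<And>y. \<bar>exit_flux g v y\<bar> \<le> B * norm v"
    using exit_flux_bound by blast
  obtain K4 where K4: "0 < K4" "\<And>w. energy w \<le> K4 * (norm w)\<^sup>2"
    using energy_le by blast
  obtain K5 where K5: "0 < K5" "\<And>v. norm (fast_part v) \<le> K5 * norm v"
    using linear_bounded_pos[OF linear_fast_part] by blast
  \<comment> \<open>One constant dominating all those required by the Lyapunov estimate.\<close>
  define K where "K = 2 * K2 + 2 * B + K4 + 2 * K3"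
  have K: "0 < K" "2 * K2 \<le> K" "2 * B \<le> K" "K4 \<le> K" "2 * K3 \<le> K"
    using K2 K3 K4 B by (auto simp: K_def)
  \<comment> \<open>The derivative of the energy is twice the sum bounded in \<open>diss\<close>,
    hence the rate \<open>2 * \<kappa>\<close>.\<close>
  obtain \<alpha> \<epsilon>\<^sub>3 \<beta> where \<alpha>: "0 < \<alpha>" and \<epsilon>\<^sub>3: "0 < \<epsilon>\<^sub>3" and \<beta>: "0 < \<beta>" and lyapunov:
    "\<And>\<epsilon> \<sigma> d p j \<omega> E E'. \<lbrakk>0 < \<epsilon>; \<epsilon> < \<epsilon>\<^sub>3; \<Lambda> / 2 \<le> \<sigma>; \<bar>\<sigma> - \<Lambda>\<bar> \<le> K * \<epsilon>; \<bar>j\<bar> \<le> K * \<omega>; 0 \<le> \<omega>;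
      E \<le> K * \<omega>\<^sup>2; E' \<le> - (2 * \<kappa> / \<epsilon>) * \<omega>\<^sup>2 + K * \<omega> * (\<omega> + 2 * \<bar>p\<bar>)\<rbrakk> \<Longrightarrow>
      2 * d * (- \<sigma> * d + (\<sigma> - \<Lambda>) * p + j) + \<alpha> * \<epsilon> * (2 * p * (- \<Lambda> * p + j) + E')
        \<le> - \<beta> * (d\<^sup>2 + \<alpha> * \<epsilon> * (p\<^sup>2 + E))"
    using lyapunov_dissipation[OF \<Lambda> _ K(1), of "2 * \<kappa>"] \<kappa> by (metis mult_pos_pos zero_less_numeral)
  define M where "M = \<alpha> * (1 + K4 * (2 * K5)\<^sup>2)"
  have "0 < 1 + K4 * (2 * K5)\<^sup>2"
    using K4 by (intro add_pos_nonneg) auto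
  then have M: "0 < M" using \<alpha> by (simp add: M_def)
  show thesis
  proof (rule that[OF c _ M \<beta>])
    \<comment> \<open>The bound \<open>\<Lambda> / (2 * K)\<close> keeps the effective rate
      \<open>\<sigma>\<close> above \<open>\<Lambda> / 2\<close>.\<close>
    show "0 < min \<epsilon>\<^sub>2 (min \<epsilon>\<^sub>3 (\<Lambda> / (2 * K)))" using \<epsilon>\<^sub>2 \<epsilon>\<^sub>3 \<Lambda> K by simp
    fix \<epsilon> \<rho> \<mu>\<^sub>0 \<eta>\<^sub>0 \<mu> \<eta> and T :: real
    assume \<epsilon>: "0 < \<epsilon>" "\<epsilon> < min \<epsilon>\<^sub>2 (min \<epsilon>\<^sub>3 (\<Lambda> / (2 * K)))"
      and \<rho>: "positive_steady_state (full_generator q g \<epsilon>) \<rho>"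
      and \<mu>0: "\<mu>\<^sub>0 \<in> prob_vectors" and \<eta>0: "\<eta>\<^sub>0 \<in> prob_vectors"
      and \<mu>: "forward_solution (full_generator q g \<epsilon>) \<mu>\<^sub>0 \<mu>"
      and \<eta>: "forward_solution (effective_generator (full_generator q g \<epsilon>) \<rho>) \<eta>\<^sub>0 \<eta>"
      and T: "0 \<le> T"
    let ?L = "full_generator q g \<epsilon>"
    define r where "r y = exit_flux g \<rho> y / cg_push \<rho> $ y" for y
    define \<sigma> where "\<sigma> = r 0 + r 1"
    have \<rho>0: "transpose ?L *v \<rho> = 0" and \<rho>p: "\<rho> \<in> prob_vectors"
      using \<rho> by (simp_all only: positive_steady_state_def)
    have mass: "cg_push v $ 0 + cg_push v $ 1 = 1" if "v \<in> prob_vectors" for v :: "real ^ (2 \<times> 'z)"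
      using cg_push_prob_vectors[OF that] by (simp add: prob_vectors_def sum_UNIV_2)
    have r: "c \<le> cg_push \<rho> $ y" "\<bar>r y - exit_flux g p y\<bar> \<le> K2 * \<epsilon>" for y
      using steady[OF \<epsilon>(1) _ \<rho>, of y] \<epsilon> by (auto simp: r_def)
    have \<sigma>\<Lambda>: "\<bar>\<sigma> - \<Lambda>\<bar> \<le> K * \<epsilon>"
    proof -
      have "\<bar>\<sigma> - \<Lambda>\<bar> \<le> 2 * K2 * \<epsilon>"
        using r(2)[of 0] r(2)[of 1] unfolding \<sigma>_def \<Lambda>_def by linarith
      also have "\<dots> \<le> K * \<epsilon>" using K \<epsilon> by (intro mult_right_mono) auto
      finally show ?thesis .
    qed
    have "K * \<epsilon> \<le> \<Lambda> / 2" using \<epsilon> K by (simp add: field_simps)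
    with \<sigma>\<Lambda> have \<sigma>: "\<Lambda> / 2 \<le> \<sigma>" by linarith
    have \<mu>_mass: "cg_push (\<mu> t) $ 0 + cg_push (\<mu> t) $ 1 = 1" if "0 \<le> t" for t
    proof -
      have "linear (\<lambda>v :: real ^ (2 \<times> 'z). cg_push v $ 0 + cg_push v $ 1)"
        by (intro linear_compose_add linear_cg_push_nth)
      from forward_solution_linear_constant[OF \<mu> this _ that]
      show ?thesis
        using mass[OF \<mu>0] by (simp add: cg_push_full_generator[OF q] del: transpose_matrix_vector)
    qed
    note \<eta>_sol = effective_solution[OF q \<rho> \<eta>0 \<eta>, folded r_def, folded \<sigma>_def]
    \<comment> \<open>\<open>\<eta> T\<close> is a convex combination of its initial value and the
      equilibrium \<open>cg_push \<rho>\<close>, whose entries are at least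
      \<open>c\<close>.\<close>
    have \<eta>_lower: "min c (\<eta>\<^sub>0 $ y) \<le> \<eta> T $ y" for y
    proof -
      define e where "e = exp (- \<sigma> * T)"
      have e: "0 \<le> e" "e \<le> 1" using \<sigma> \<Lambda> T by (auto simp: e_def)
      have "min c (\<eta>\<^sub>0 $ y) = (1 - e) * min c (\<eta>\<^sub>0 $ y) + e * min c (\<eta>\<^sub>0 $ y)"
        by (simp add: algebra_simps)
      also have "\<dots> \<le> (1 - e) * cg_push \<rho> $ y + e * \<eta>\<^sub>0 $ y"
        using e r(1)[of y] by (intro add_mono mult_left_mono) auto
      also have "\<dots> = \<eta> T $ y"
        using \<eta>_sol(3)[OF T, of y] by (simp add: e_def algebra_simps)
      finally show ?thesis .
    qed
    define v where "v t = \<mu> t - \<rho>" for t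
    define P where "P t = cg_push (v t) $ 0" for t
    define j where "j t = exit_flux g (fast_part (v t)) 1 - exit_flux g (fast_part (v t)) 0" for t
    define E where "E t = energy (fast_part (v t))" for t
    define E' where "E' t = 2 * (\<Sum>x\<in>UNIV. fast_part (v t) $ x / p $ x * (transpose ?L *v v t) $ x)" for t
    define d where "d t = cg_push (\<mu> t) $ 0 - \<eta> t $ 0" for t
    define V where "V t = (d t)\<^sup>2 + \<alpha> * \<epsilon> * ((P t)\<^sup>2 + E t)" for t
    have P1: "cg_push (v t) $ 1 = - P t" if "0 \<le> t" for t
      using \<mu>_mass[OF that] mass[OF \<rho>p]
      by (simp add: P_def v_def linear_diff[OF linear_cg_push_nth])
    have v_der: "(v has_vector_derivative transpose ?L *v v t) (at t within {0..})" if "0 \<le> t" for t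
    proof -
      have "transpose ?L *v v t = transpose ?L *v \<mu> t - 0"
        unfolding v_def \<rho>0[symmetric] by (rule matrix_vector_mult_diff_distrib)
      moreover have "(\<mu> has_vector_derivative transpose ?L *v \<mu> t) (at t within {0..})"
        using \<mu> that by (simp only: forward_solution_def)
      ultimately show ?thesis
        unfolding v_def[abs_def] by (auto intro!: derivative_eq_intros simp del: transpose_matrix_vector)
    qed
    have P_der: "(P has_real_derivative - \<Lambda> * P t + j t) (at t within {0..})" if "0 \<le> t" for t
    proof -
      have "bounded_linear (\<lambda>v :: real ^ (2 \<times> 'z). cg_push v $ 0)"
        using linear_cg_push_nth by (simp add: linear_conv_bounded_linear)
      from bounded_linear.has_vector_derivative[OF this v_der[OF that]]
      have "(P has_real_derivative cg_push (transpose ?L *v v t) $ 0) (at t within {0..})"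
        by (simp only: P_def[abs_def] has_real_derivative_iff_has_vector_derivative)
      moreover have "cg_push (transpose ?L *v v t) $ 0 = exit_flux g (v t) 1 - exit_flux g (v t) 0"
        using cg_push_full_generator[of q g \<epsilon> "v t" 0, OF q] by simp
      moreover have "\<dots> = - \<Lambda> * P t + j t"
        unfolding exit_flux_decomp[of g "v t"] P1[OF that]
        by (simp add: j_def \<Lambda>_def P_def algebra_simps)
      ultimately show ?thesis by (simp only:)
    qed
    have d_eq: "d t = P t - (\<eta> t $ 0 - cg_push \<rho> $ 0)" for t
      by (simp add: d_def P_def v_def linear_diff[OF linear_cg_push_nth])
    \<comment> \<open>\<open>P\<close> relaxes at rate \<open>\<Lambda>\<close> and the deviation of
      \<open>\<eta>\<close> at rate \<open>\<sigma>\<close>; expressing that deviation as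
      \<open>P - d\<close> leaves the mismatch \<open>(\<sigma> - \<Lambda>) * P\<close>.\<close>
    have d_der: "(d has_real_derivative - \<sigma> * d t + (\<sigma> - \<Lambda>) * P t + j t) (at t within {0..})"
      if "0 \<le> t" for t
    proof -
      have "((\<lambda>t. P t - (\<eta> t $ 0 - cg_push \<rho> $ 0)) has_real_derivative
          - \<Lambda> * P t + j t - (- \<sigma> * (\<eta> t $ 0 - cg_push \<rho> $ 0) - 0)) (at t within {0..})"
        by (intro DERIV_diff P_der \<eta>_sol(2) DERIV_const that)
      moreover have "- \<Lambda> * P t + j t - (- \<sigma> * (\<eta> t $ 0 - cg_push \<rho> $ 0) - 0) =
          - \<sigma> * d t + (\<sigma> - \<Lambda>) * P t + j t"
        by (simp add: d_eq algebra_simps)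
      moreover have "d = (\<lambda>t. P t - (\<eta> t $ 0 - cg_push \<rho> $ 0))"
        using d_eq by (rule ext)
      ultimately show ?thesis by (simp only:)
    qed
    have E_der: "(E has_real_derivative E' t) (at t within {0..})" if "0 \<le> t" for t
      unfolding E_def[abs_def] E'_def by (rule energy_derivative[OF v_der[OF that]])
    have V_der: "(V has_real_derivative 2 * d t * (- \<sigma> * d t + (\<sigma> - \<Lambda>) * P t + j t) +
        \<alpha> * \<epsilon> * (2 * P t * (- \<Lambda> * P t + j t) + E' t)) (at t within {0..})" if "0 \<le> t" for t
      unfolding V_def[abs_def]
      by (rule derivative_eq_intros d_der P_der E_der that refl)+ (simp add: power2_eq_square)
    have V_le: "2 * d t * (- \<sigma> * d t + (\<sigma> - \<Lambda>) * P t + j t) +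
        \<alpha> * \<epsilon> * (2 * P t * (- \<Lambda> * P t + j t) + E' t) \<le> - \<beta> * V t" if "0 \<le> t" for t
      unfolding V_def
    proof (rule lyapunov[OF \<epsilon>(1) _ \<sigma> \<sigma>\<Lambda>])
      let ?\<omega> = "norm (fast_part (v t))"
      show "\<epsilon> < \<epsilon>\<^sub>3" using \<epsilon> by simp
      show "0 \<le> ?\<omega>" by simp
      show "\<bar>j t\<bar> \<le> K * ?\<omega>"
      proof -
        have "\<bar>j t\<bar> \<le> 2 * B * ?\<omega>"
          using B(2)[of "fast_part (v t)" 0] B(2)[of "fast_part (v t)" 1] unfolding j_def by linarith
        also have "\<dots> \<le> K * ?\<omega>" using K by (intro mult_right_mono) auto
        finally show ?thesis .
      qed
      show "E t \<le> K * ?\<omega>\<^sup>2"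
      proof -
        have "E t \<le> K4 * ?\<omega>\<^sup>2" unfolding E_def by (rule K4)
        also have "\<dots> \<le> K * ?\<omega>\<^sup>2" using K by (intro mult_right_mono) auto
        finally show ?thesis .
      qed
      show "E' t \<le> - (2 * \<kappa> / \<epsilon>) * ?\<omega>\<^sup>2 + K * ?\<omega> * (?\<omega> + 2 * \<bar>P t\<bar>)"
      proof -
        have "E' t \<le> - (2 * \<kappa> / \<epsilon>) * ?\<omega>\<^sup>2 + 2 * K3 * ?\<omega> * norm (v t)"
          using diss[OF \<epsilon>(1), of "v t"] by (simp add: E'_def del: transpose_matrix_vector)
        \<comment> \<open>The two level masses of \<open>v t\<close> are \<open>P t\<close> and
          \<open>- P t\<close>, which explains the factor 2 at
          \<open>\<bar>P t\<bar>\<close>.\<close>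
        also have "2 * K3 * ?\<omega> * norm (v t) \<le> K * ?\<omega> * (?\<omega> + 2 * \<bar>P t\<bar>)"
          using norm_le_fast_part[of "v t"] K K3 P1[OF that]
          by (intro mult_mono) (auto simp: P_def)
        finally show ?thesis by simp
      qed
    qed
    have "V T \<le> V 0 * exp (- \<beta> * T)"
      by (rule exp_decay[OF V_der V_le T])
    \<comment> \<open>The initial fast part is merely bounded; the weight \<open>\<epsilon>\<close>
      in \<open>V\<close> turns it into an error of order \<open>\<epsilon>\<close>.\<close>
    also have "\<dots> \<le> ((d 0)\<^sup>2 + M * \<epsilon>) * exp (- \<beta> * T)"
    proof (intro mult_right_mono)
      have v0: "v 0 = \<mu>\<^sub>0 - \<rho>" using \<mu> by (simp add: v_def forward_solution_def)
      have "\<bar>P 0\<bar> \<le> 1"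
      proof -
        have "0 \<le> cg_push \<mu>\<^sub>0 $ 0" "cg_push \<mu>\<^sub>0 $ 0 \<le> 1" "0 \<le> cg_push \<rho> $ 0" "cg_push \<rho> $ 0 \<le> 1"
          using cg_push_prob_vectors[OF \<mu>0] cg_push_prob_vectors[OF \<rho>p]
          by (auto intro: prob_vectors_le_1) (auto simp: prob_vectors_def)
        then show ?thesis by (simp add: P_def v0 linear_diff[OF linear_cg_push_nth])
      qed
      then have "\<bar>P 0\<bar>\<^sup>2 \<le> 1" by (intro power_le_one) auto
      moreover have "E 0 \<le> K4 * (2 * K5)\<^sup>2"
      proof -
        have "norm (v 0) \<le> 2"
          using norm_triangle_ineq4[of \<mu>\<^sub>0 \<rho>] prob_vectors_norm_le_1[OF \<mu>0] prob_vectors_norm_le_1[OF \<rho>p]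
          by (simp add: v0)
        then have "K5 * norm (v 0) \<le> K5 * 2" using K5 by (intro mult_left_mono) auto
        then have "norm (fast_part (v 0)) \<le> 2 * K5" using K5(2)[of "v 0"] by simp
        then have "K4 * (norm (fast_part (v 0)))\<^sup>2 \<le> K4 * (2 * K5)\<^sup>2"
          using K4(1) by (intro mult_left_mono power_mono) auto
        then show ?thesis using K4(2)[of "fast_part (v 0)"] by (simp add: E_def)
      qed
      ultimately have "\<alpha> * \<epsilon> * ((P 0)\<^sup>2 + E 0) \<le> \<alpha> * \<epsilon> * (1 + K4 * (2 * K5)\<^sup>2)"
        using \<alpha> \<epsilon> by (intro mult_left_mono add_mono) auto
      then show "V 0 \<le> (d 0)\<^sup>2 + M * \<epsilon>" by (simp add: V_def M_def ac_simps)
    qed simp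
    finally have "V T \<le> ((d 0)\<^sup>2 + M * \<epsilon>) * exp (- \<beta> * T)" .
    moreover have "0 \<le> \<alpha> * \<epsilon> * ((P T)\<^sup>2 + E T)"
      using \<alpha> \<epsilon> by (intro mult_nonneg_nonneg add_nonneg_nonneg) (auto simp: E_def energy_nonneg)
    then have "(d T)\<^sup>2 \<le> V T" by (simp add: V_def)
    moreover have "d 0 = cg_push \<mu>\<^sub>0 $ 0 - \<eta>\<^sub>0 $ 0"
      using \<mu> \<eta> by (simp add: d_def forward_solution_def)
    ultimately show "cg_push (\<mu> T) $ 0 + cg_push (\<mu> T) $ 1 = 1 \<and> \<eta> T $ 0 + \<eta> T $ 1 = 1 \<and>
        (\<forall>y. min c (\<eta>\<^sub>0 $ y) \<le> \<eta> T $ y) \<and>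
        (cg_push (\<mu> T) $ 0 - \<eta> T $ 0)\<^sup>2 \<le>
          ((cg_push \<mu>\<^sub>0 $ 0 - \<eta>\<^sub>0 $ 0)\<^sup>2 + M * \<epsilon>) * exp (- \<beta> * T)"
      using \<mu>_mass[OF T] \<eta>_sol(1)[OF T] \<eta>_lower by (auto simp: d_def)
  qed
qed

end

section \<open>Return from the squared error to the entropy\<close>

theorem theorem5p6:
  fixes q g :: "2 \<Rightarrow> real ^ 'z ^ 'z::finite"
    and \<rho> :: "real \<Rightarrow> real ^ (2 \<times> 'z)"
  assumes "\<And>y. irreducible_generator (q y)"
    and "\<And>y z z'. 0 \<le> g y $ z $ z'"
    and "\<And>\<epsilon>. 0 < \<epsilon> \<Longrightarrow> irreducible_generator (full_generator q g \<epsilon>)"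
    and "\<And>\<epsilon>. 0 < \<epsilon> \<Longrightarrow> positive_steady_state (full_generator q g \<epsilon>) (\<rho> \<epsilon>)"
  shows
    "\<forall>c\<^sub>0>0. \<forall>C\<^sub>0>0. \<exists>\<epsilon>\<^sub>0>0. \<exists>C\<^sub>1>0. \<exists>C\<^sub>2>0. \<exists>\<beta>>0.
      \<forall>(\<mu>\<^sub>0 :: real \<Rightarrow> real ^ (2 \<times> 'z)) (\<eta>\<^sub>0 :: real \<Rightarrow> real ^ 2)
       (\<mu> :: real \<Rightarrow> real \<Rightarrow> real ^ (2 \<times> 'z)) (\<eta> :: real \<Rightarrow> real \<Rightarrow> real ^ 2).
        (\<forall>\<epsilon>\<in>{0<..<\<epsilon>\<^sub>0}.
            \<mu>\<^sub>0 \<epsilon> \<in> prob_vectors \<and> \<eta>\<^sub>0 \<epsilon> \<in> prob_vectors \<and>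
            forward_solution (full_generator q g \<epsilon>) (\<mu>\<^sub>0 \<epsilon>) (\<mu> \<epsilon>) \<and>
            forward_solution (effective_generator (full_generator q g \<epsilon>) (\<rho> \<epsilon>))
              (\<eta>\<^sub>0 \<epsilon>) (\<eta> \<epsilon>)) \<longrightarrow>
        (\<forall>\<epsilon>\<in>{0<..<\<epsilon>\<^sub>0}. \<forall>y. c\<^sub>0 \<le> cg_push (\<mu>\<^sub>0 \<epsilon>) $ y \<and> c\<^sub>0 \<le> \<eta>\<^sub>0 \<epsilon> $ y) \<longrightarrow>
        converges_in_prob_vectors \<mu>\<^sub>0 \<longrightarrow>
        converges_in_prob_vectors (\<lambda>\<epsilon>. cg_push (\<mu>\<^sub>0 \<epsilon>)) \<longrightarrow>
        converges_in_prob_vectors \<eta>\<^sub>0 \<longrightarrow>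
        (\<forall>\<epsilon>\<in>{0<..<\<epsilon>\<^sub>0}.
            entropy_fun (\<eta>\<^sub>0 \<epsilon>) (ratio_density (cg_push (\<mu>\<^sub>0 \<epsilon>)) (\<eta>\<^sub>0 \<epsilon>)) \<le> C\<^sub>0 * \<epsilon>) \<longrightarrow>
        (\<forall>\<epsilon>\<in>{0<..<\<epsilon>\<^sub>0}. \<forall>t\<ge>0.
            entropy_fun (\<eta> \<epsilon> t) (ratio_density (cg_push (\<mu> \<epsilon> t)) (\<eta> \<epsilon> t))
              \<le> \<epsilon> * C\<^sub>1 * exp (- \<beta> * t)) \<and>
        (\<forall>\<epsilon>\<in>{0<..<\<epsilon>\<^sub>0}.
            (SUP t\<in>{0..}.
               ereal (entropy_fun (\<eta> \<epsilon> t) (ratio_density (cg_push (\<mu> \<epsilon> t)) (\<eta> \<epsilon> t))))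
              \<le> ereal (C\<^sub>2 * \<epsilon>))"
proof (intro allI impI)
  obtain p where "fast_stationary q p"
    by (rule fast_stationary_exists[OF assms(1)])
  then interpret fast_stationary q p .
  \<comment> \<open>The flux does not involve \<open>\<epsilon>\<close>, so irreducibility at the
    single value 1 suffices.\<close>
  have "0 < exit_flux g p y" for y
    using irreducible_full_generator_exit_pos[OF assms(3)[of 1] assms(2) p_pos] by simp
  then obtain c \<epsilon>\<^sub>1 K \<beta> where c: "0 < c" and \<epsilon>\<^sub>1: "0 < \<epsilon>\<^sub>1" and K: "0 < K" and \<beta>: "0 < \<beta>" and decay:
    "\<And>\<epsilon> \<rho> \<mu>\<^sub>0 \<eta>\<^sub>0 \<mu> \<eta> t. \<lbrakk>0 < \<epsilon>; \<epsilon> < \<epsilon>\<^sub>1; positive_steady_state (full_generator q g \<epsilon>) \<rho>;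
      \<mu>\<^sub>0 \<in> prob_vectors; \<eta>\<^sub>0 \<in> prob_vectors; forward_solution (full_generator q g \<epsilon>) \<mu>\<^sub>0 \<mu>;
      forward_solution (effective_generator (full_generator q g \<epsilon>) \<rho>) \<eta>\<^sub>0 \<eta>; 0 \<le> t\<rbrakk> \<Longrightarrow>
      cg_push (\<mu> t) $ 0 + cg_push (\<mu> t) $ 1 = 1 \<and> \<eta> t $ 0 + \<eta> t $ 1 = 1 \<and>
      (\<forall>y. min c (\<eta>\<^sub>0 $ y) \<le> \<eta> t $ y) \<and>
      (cg_push (\<mu> t) $ 0 - \<eta> t $ 0)\<^sup>2 \<le>
        ((cg_push \<mu>\<^sub>0 $ 0 - \<eta>\<^sub>0 $ 0)\<^sup>2 + K * \<epsilon>) * exp (- \<beta> * t)"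
    using slow_error_decay[of g] by blast
  fix c\<^sub>0 C\<^sub>0 :: real
  assume c0: "0 < c\<^sub>0" and C0: "0 < C\<^sub>0"
  \<comment> \<open>\<open>k\<close> bounds \<open>\<eta>\<close> from below for all times.
    \<open>D\<close> adds the initial squared error, at most
    \<open>2 * C\<^sub>0 * \<epsilon>\<close> by the entropy assumption, to the fast contribution
    \<open>K\<close>. The bound \<open>k\<^sup>2 / D\<close> on \<open>\<epsilon>\<close> keeps the
    error below \<open>k\<close>, and \<open>2 / k\<close> is the price of returning to the
    entropy.\<close>
  define k where "k = min c c\<^sub>0"
  define D where "D = 2 * C\<^sub>0 + K"
  define \<epsilon>\<^sub>0 where "\<epsilon>\<^sub>0 = min \<epsilon>\<^sub>1 (k\<^sup>2 / D)"
  define C where "C = 2 / k * D"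
  have k: "0 < k" using c c0 by (simp add: k_def)
  have D: "0 < D" using C0 K by (simp add: D_def)
  have C: "0 < C" using k D by (simp add: C_def)
  have \<epsilon>\<^sub>0: "0 < \<epsilon>\<^sub>0" using \<epsilon>\<^sub>1 k D by (simp add: \<epsilon>\<^sub>0_def)
  have main: "entropy_fun (\<eta> t) (ratio_density (cg_push (\<mu> t)) (\<eta> t)) \<le> \<epsilon> * C * exp (- \<beta> * t)"
    if \<epsilon>: "\<epsilon> \<in> {0<..<\<epsilon>\<^sub>0}" and prob: "\<mu>\<^sub>0 \<in> prob_vectors" "\<eta>\<^sub>0 \<in> prob_vectors"
      and sol: "forward_solution (full_generator q g \<epsilon>) \<mu>\<^sub>0 \<mu>"
        "forward_solution (effective_generator (full_generator q g \<epsilon>) (\<rho> \<epsilon>)) \<eta>\<^sub>0 \<eta>"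
      and low: "\<forall>y. c\<^sub>0 \<le> cg_push \<mu>\<^sub>0 $ y \<and> c\<^sub>0 \<le> \<eta>\<^sub>0 $ y"
      and ent: "entropy_fun \<eta>\<^sub>0 (ratio_density (cg_push \<mu>\<^sub>0) \<eta>\<^sub>0) \<le> C\<^sub>0 * \<epsilon>"
      and t: "0 \<le> t"
    for \<epsilon> t \<mu>\<^sub>0 \<eta>\<^sub>0 \<mu> \<eta>
  proof -
    have \<epsilon>': "0 < \<epsilon>" "\<epsilon> < \<epsilon>\<^sub>1" "\<epsilon> < k\<^sup>2 / D" using \<epsilon> by (auto simp: \<epsilon>\<^sub>0_def)
    let ?m = "cg_push (\<mu> t)" and ?e = "exp (- \<beta> * t)"
    define d where "d = ?m $ 0 - \<eta> t $ 0"
    from decay[OF \<epsilon>'(1,2) assms(4)[OF \<epsilon>'(1)] prob sol t]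
    have sums: "?m $ 0 + ?m $ 1 = 1" "\<eta> t $ 0 + \<eta> t $ 1 = 1"
      and lower: "\<And>y. min c (\<eta>\<^sub>0 $ y) \<le> \<eta> t $ y"
      and d: "d\<^sup>2 \<le> ((cg_push \<mu>\<^sub>0 $ 0 - \<eta>\<^sub>0 $ 0)\<^sup>2 + K * \<epsilon>) * ?e"
      by (auto simp: d_def)
    have \<eta>k: "k \<le> \<eta> t $ y" for y
      using lower[of y] low[rule_format, of y] by (auto simp: k_def)
    have "(cg_push \<mu>\<^sub>0 $ 0 - \<eta>\<^sub>0 $ 0)\<^sup>2 \<le> 2 * (C\<^sub>0 * \<epsilon>)"
    proof -
      have "0 < cg_push \<mu>\<^sub>0 $ y" "0 < \<eta>\<^sub>0 $ y" for y
        using low[rule_format, of y] c0 by auto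
      then show ?thesis
        using square_diff_le_entropy[OF cg_push_prob_vectors[OF prob(1)] _ prob(2)] ent by fastforce
    qed
    then have "((cg_push \<mu>\<^sub>0 $ 0 - \<eta>\<^sub>0 $ 0)\<^sup>2 + K * \<epsilon>) * ?e \<le> D * \<epsilon> * ?e"
      by (intro mult_right_mono) (auto simp: D_def algebra_simps)
    with d have d_le: "d\<^sup>2 \<le> D * \<epsilon> * ?e" by linarith
    also have "\<dots> \<le> D * \<epsilon> * 1"
      using D \<epsilon>' \<beta> t by (intro mult_left_mono) auto
    also have "\<dots> \<le> k\<^sup>2" using \<epsilon>'(3) D by (simp add: field_simps)
    finally have "\<bar>d\<bar> \<le> k" using k by (simp add: abs_le_square_iff[of d k, symmetric])
    \<comment> \<open>The entries of \<open>?m\<close> are those of \<open>\<eta> t\<close> plus or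
      minus \<open>d\<close>, and \<open>\<bar>d\<bar> \<le> k\<close> while \<open>\<eta> t\<close>
      is at least \<open>k\<close>.\<close>
    then have "0 \<le> ?m $ 0" "0 \<le> ?m $ 1"
      using \<eta>k[of 0] \<eta>k[of 1] sums unfolding d_def by linarith+
    then have "\<forall>y. 0 \<le> ?m $ y" by (simp add: all_2_iff)
    then have "entropy_fun (\<eta> t) (ratio_density ?m (\<eta> t)) \<le> 2 / k * d\<^sup>2"
      unfolding d_def by (intro entropy_le_square_diff sums \<eta>k k) auto
    also have "\<dots> \<le> 2 / k * (D * \<epsilon> * ?e)"
      using d_le k by (intro mult_left_mono) auto
    also have "\<dots> = \<epsilon> * C * ?e" by (simp add: C_def)
    finally show ?thesis .
  qed
  show "\<exists>\<epsilon>\<^sub>0>0. \<exists>C\<^sub>1>0. \<exists>C\<^sub>2>0. \<exists>\<beta>>0.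
      \<forall>(\<mu>\<^sub>0 :: real \<Rightarrow> real ^ (2 \<times> 'z)) (\<eta>\<^sub>0 :: real \<Rightarrow> real ^ 2)
       (\<mu> :: real \<Rightarrow> real \<Rightarrow> real ^ (2 \<times> 'z)) (\<eta> :: real \<Rightarrow> real \<Rightarrow> real ^ 2).
        (\<forall>\<epsilon>\<in>{0<..<\<epsilon>\<^sub>0}.
            \<mu>\<^sub>0 \<epsilon> \<in> prob_vectors \<and> \<eta>\<^sub>0 \<epsilon> \<in> prob_vectors \<and>
            forward_solution (full_generator q g \<epsilon>) (\<mu>\<^sub>0 \<epsilon>) (\<mu> \<epsilon>) \<and>
            forward_solution (effective_generator (full_generator q g \<epsilon>) (\<rho> \<epsilon>))
              (\<eta>\<^sub>0 \<epsilon>) (\<eta> \<epsilon>)) \<longrightarrow>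
        (\<forall>\<epsilon>\<in>{0<..<\<epsilon>\<^sub>0}. \<forall>y. c\<^sub>0 \<le> cg_push (\<mu>\<^sub>0 \<epsilon>) $ y \<and> c\<^sub>0 \<le> \<eta>\<^sub>0 \<epsilon> $ y) \<longrightarrow>
        converges_in_prob_vectors \<mu>\<^sub>0 \<longrightarrow>
        converges_in_prob_vectors (\<lambda>\<epsilon>. cg_push (\<mu>\<^sub>0 \<epsilon>)) \<longrightarrow>
        converges_in_prob_vectors \<eta>\<^sub>0 \<longrightarrow>
        (\<forall>\<epsilon>\<in>{0<..<\<epsilon>\<^sub>0}.
            entropy_fun (\<eta>\<^sub>0 \<epsilon>) (ratio_density (cg_push (\<mu>\<^sub>0 \<epsilon>)) (\<eta>\<^sub>0 \<epsilon>)) \<le> C\<^sub>0 * \<epsilon>) \<longrightarrow>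
        (\<forall>\<epsilon>\<in>{0<..<\<epsilon>\<^sub>0}. \<forall>t\<ge>0.
            entropy_fun (\<eta> \<epsilon> t) (ratio_density (cg_push (\<mu> \<epsilon> t)) (\<eta> \<epsilon> t))
              \<le> \<epsilon> * C\<^sub>1 * exp (- \<beta> * t)) \<and>
        (\<forall>\<epsilon>\<in>{0<..<\<epsilon>\<^sub>0}.
            (SUP t\<in>{0..}.
               ereal (entropy_fun (\<eta> \<epsilon> t) (ratio_density (cg_push (\<mu> \<epsilon> t)) (\<eta> \<epsilon> t))))
              \<le> ereal (C\<^sub>2 * \<epsilon>))"
  \<comment> \<open>The same \<open>C\<close> serves as both constants, since the exponential factor
    is at most one.\<close>
  proof (rule exI[of _ \<epsilon>\<^sub>0], rule conjI[OF \<epsilon>\<^sub>0], rule exI[of _ C], rule conjI[OF C],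
      rule exI[of _ C], rule conjI[OF C], rule exI[of _ \<beta>], rule conjI[OF \<beta>],
      intro allI impI conjI ballI)
    fix \<mu>\<^sub>0 \<eta>\<^sub>0 \<mu> \<eta> \<epsilon> t
    assume "\<forall>\<epsilon>\<in>{0<..<\<epsilon>\<^sub>0}. \<mu>\<^sub>0 \<epsilon> \<in> prob_vectors \<and> \<eta>\<^sub>0 \<epsilon> \<in> prob_vectors \<and>
            forward_solution (full_generator q g \<epsilon>) (\<mu>\<^sub>0 \<epsilon>) (\<mu> \<epsilon>) \<and>
            forward_solution (effective_generator (full_generator q g \<epsilon>) (\<rho> \<epsilon>)) (\<eta>\<^sub>0 \<epsilon>) (\<eta> \<epsilon>)"
      and "\<forall>\<epsilon>\<in>{0<..<\<epsilon>\<^sub>0}. \<forall>y. c\<^sub>0 \<le> cg_push (\<mu>\<^sub>0 \<epsilon>) $ y \<and> c\<^sub>0 \<le> \<eta>\<^sub>0 \<epsilon> $ y"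
      and "\<forall>\<epsilon>\<in>{0<..<\<epsilon>\<^sub>0}.
            entropy_fun (\<eta>\<^sub>0 \<epsilon>) (ratio_density (cg_push (\<mu>\<^sub>0 \<epsilon>)) (\<eta>\<^sub>0 \<epsilon>)) \<le> C\<^sub>0 * \<epsilon>"
      and \<epsilon>: "\<epsilon> \<in> {0<..<\<epsilon>\<^sub>0}"
    then have bound: "entropy_fun (\<eta> \<epsilon> t) (ratio_density (cg_push (\<mu> \<epsilon> t)) (\<eta> \<epsilon> t))
              \<le> \<epsilon> * C * exp (- \<beta> * t)" if "0 \<le> t" for t
      using that by (intro main[of \<epsilon> "\<mu>\<^sub>0 \<epsilon>" "\<eta>\<^sub>0 \<epsilon>"]) auto
    show "entropy_fun (\<eta> \<epsilon> t) (ratio_density (cg_push (\<mu> \<epsilon> t)) (\<eta> \<epsilon> t))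
              \<le> \<epsilon> * C * exp (- \<beta> * t)" if "0 \<le> t"
      using that by (rule bound)
    show "(SUP t\<in>{0..}.
               ereal (entropy_fun (\<eta> \<epsilon> t) (ratio_density (cg_push (\<mu> \<epsilon> t)) (\<eta> \<epsilon> t))))
              \<le> ereal (C * \<epsilon>)"
    proof (rule SUP_least)
      fix t :: real assume "t \<in> {0..}"
      then have t: "0 \<le> t" by simp
      have "\<epsilon> * C * exp (- \<beta> * t) \<le> \<epsilon> * C * 1"
        using \<epsilon> C \<beta> t by (intro mult_left_mono) auto
      with bound[OF t]
      show "ereal (entropy_fun (\<eta> \<epsilon> t) (ratio_density (cg_push (\<mu> \<epsilon> t)) (\<eta> \<epsilon> t))) \<le> ereal (C * \<epsilon>)"
        by (simp add: mult.commute)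
    qed
  qed
qed

end
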